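(* Let $d\ge 2$, let $A,B\ge 1$ be constants, and let $\psi:[0,1]\to[0,\infty)$ be a monotone increasing continuous function with $\lim_{t\to0^+}\psi(t)=0$. There exists a (small) constant $c_0>0$, depending only on $A,B,d$ and $\psi$, such that for every measure $\mu\in\mathcal M_\psi(\mathbb R^d)$ there exists a (small) constant $\Delta=\Delta(A,B,d,\mu)>0$, used in the definition of oscillation in a basic cube, for which the following holds. Let $f:(0,\infty)\to(0,\infty)$ be a monotone non-decreasing function with $f(t)\le t^d$, and suppose $f(t)\le c_0\,t^d$ for all sufficiently large $t$. Then every $f$-oscillating function $u\in\mathcal F(A,B,\mu)$ satisfies $$\liminf_{R\to\infty}\ \frac{\log\left(M_u(R)\right)}{\dfrac{R}{1+\left(\frac{f(R)}{R}\right)^{\frac1{d-1}}}\,\log^{\frac d{d-1}}\left(2+\frac{f(R)}{R}\right)}>0,$$ where $M_u(R):=\sup_{z\in B(0,R)}u(z)$.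
   Context: Notation: $m_d$ is $d$-dimensional Lebesgue measure, $B(x,r)$ is the Euclidean ball of center $x$ and radius $r$ in $\mathbb R^d$, and $\log^{p}(y)$ means $(\log y)^p$. Class of measures. $\mathcal M_\psi(\mathbb R^d)$ is the collection of all Borel measures $\mu$ on $\mathbb R^d$ of the form $d\mu(x)=\omega(x)\,dm_d(x)$, with $\omega:\mathbb R^d\to[0,\infty)$ measurable and $0<\mu(B)<\infty$ for every ball $B$, such that for every ball $B\subset\mathbb R^d$ and every Borel set $E\subset B$, $$\frac{\mu(E)}{\mu(B)}\le\psi\left(\frac{m_d(E)}{m_d(B)}\right).$$ Class of functions. Fix a constant $r_0>0$ (arbitrary). $\mathcal F(A,B,\mu)$ is the collection of upper semi-continuous functions $u:\mathbb R^d\to\mathbb R$ such that: (i) (weak maximum principle) for every nonempty bounded convex set $K\subset\mathbb R^d$, $\sup_{x\in K}u(x)\le A\cdot\sup_{x\in\partial K}u(x)$; (ii) (weighted mean-value inequality) for every $x\in\mathbb R^d$ and every $r>r_0$, $$u(x)=\operatorname{ess\,limsup}_{y\to x}u(y)\le B\cdot\frac1{\mu(B(x,r))}\int_{B(x,r)}u\,d\mu .$$ Oscillation. A basic cube is a set $I=\prod_{j=1}^d[n_j,n_j+1)$ with $n_1,\dots,n_d\in\mathbb Z$. Let $Z_u:=\{u\le0\}$. The function $u$ oscillates in a basic cube $I$ if both (P1) $\sup_{x\in I}u(x)\ge1$, and (P2) $\dfrac{\mu(I\cap Z_u)}{\mu(I)}\ge1-\Delta$ hold. Otherwise $I$ is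 called a rogue basic cube (for $u$). For a cube $Q\subset\mathbb R^d$ with edge length $\ell(Q)$ put $$\gamma(Q)=\gamma_f^u(Q)=\frac{\#\{I\subset Q:\ I\text{ is a rogue basic cube}\}}{f(\ell(Q))}.$$ The function $u$ is $f$-oscillating if $\limsup_{N\to\infty}\gamma([-N,N]^d)<1$, where $N$ ranges over the positive integers. *)

theory Defs
  imports "HOL-Analysis.Analysis" "HOL-Probability.Essential_Supremum"
begin

(* The density is taken Borel measurable: every Lebesgue measurable density agrees almost
   everywhere with a nonnegative Borel one, so the resulting class of Borel measures is the same.
   Only the values of psi on {0..1} matter. *)
definition M_class :: "(real \<Rightarrow> real) \<Rightarrow> (real^'n::finite) measure set" where
  "M_class \<psi> = {\<mu>.
     (\<exists>\<omega>. \<omega> \<in> borel_measurable borel \<and> (\<forall>x. 0 \<le> \<omega> x)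
          \<and> \<mu> = density lborel (\<lambda>x. ennreal (\<omega> x)))
   \<and> (\<forall>x r. 0 < r \<longrightarrow> 0 < emeasure \<mu> (ball x r) \<and> emeasure \<mu> (ball x r) < \<infinity>)
   \<and> (\<forall>x r E. 0 < r \<longrightarrow> E \<in> sets borel \<longrightarrow> E \<subseteq> ball x r \<longrightarrow>
        measure \<mu> E / measure \<mu> (ball x r) \<le> \<psi> (measure lborel E / measure lborel (ball x r)))}"

definition upper_semicontinuous :: "('a::topological_space \<Rightarrow> real) \<Rightarrow> bool" where
  "upper_semicontinuous u \<longleftrightarrow> (\<forall>x c. u x < c \<longrightarrow> (\<forall>\<^sub>F y in nhds x. u y < c))"

(* Limit, as s decreases to 0, of the essential suprema over ball x s with respect to Lebesgue
   measure; these are monotone in s, so the limit is an infimum. *)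
definition ess_limsup :: "(real^'n::finite \<Rightarrow> real) \<Rightarrow> real^'n \<Rightarrow> ereal" where
  "ess_limsup u x = (INF s\<in>{0<..}. esssup (restrict_space lborel (ball x s)) (\<lambda>y. ereal (u y)))"

(* The suprema are finite, since an upper semicontinuous function is bounded above on bounded sets.
   The integral over a ball is therefore either finite or minus infinity; the latter would violate
   the mean-value inequality for a real-valued u, whereas the Bochner integral would silently be 0.
   Hence integrability is stated explicitly. *)
definition F_class :: "real \<Rightarrow> real \<Rightarrow> real \<Rightarrow> (real^'n::finite) measure \<Rightarrow> (real^'n \<Rightarrow> real) set" where
  "F_class r\<^sub>0 A B \<mu> = {u. upper_semicontinuous u
   \<and> (\<forall>K. K \<noteq> {} \<longrightarrow> bounded K \<longrightarrow> convex K \<longrightarrow> (SUP x\<in>K. u x) \<le> A * (SUP x\<in>frontier K. u x))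
   \<and> (\<forall>x r. r\<^sub>0 < r \<longrightarrow>
        ereal (u x) = ess_limsup u x
      \<and> set_integrable \<mu> (ball x r) u
      \<and> u x \<le> B * (1 / measure \<mu> (ball x r) * (LINT y:ball x r|\<mu>. u y)))}"

definition basic_cubes :: "(real^'n::finite) set set" where
  "basic_cubes = {I. \<exists>k :: 'n \<Rightarrow> int. I = {x. \<forall>j. of_int (k j) \<le> x $ j \<and> x $ j < of_int (k j) + 1}}"

definition oscillates_in ::
  "real \<Rightarrow> (real^'n::finite) measure \<Rightarrow> (real^'n \<Rightarrow> real) \<Rightarrow> (real^'n) set \<Rightarrow> bool" where
  "oscillates_in \<Delta> \<mu> u I \<longleftrightarrow>
     (SUP x\<in>I. u x) \<ge> 1 \<and> measure \<mu> (I \<inter> {x. u x \<le> 0}) / measure \<mu> I \<ge> 1 - \<Delta>"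

(* The value gamma(Q) for the cube Q with least corner a and edge length l. *)
definition gamma ::
  "real \<Rightarrow> (real^'n::finite) measure \<Rightarrow> (real \<Rightarrow> real) \<Rightarrow> (real^'n \<Rightarrow> real) \<Rightarrow> real^'n \<Rightarrow> real \<Rightarrow> real" where
  "gamma \<Delta> \<mu> f u a l =
     real (card {I \<in> basic_cubes. I \<subseteq> cbox a (a + vec l) \<and> \<not> oscillates_in \<Delta> \<mu> u I}) / f l"

definition f_oscillating ::
  "real \<Rightarrow> (real^'n::finite) measure \<Rightarrow> (real \<Rightarrow> real) \<Rightarrow> (real^'n \<Rightarrow> real) \<Rightarrow> bool" where
  "f_oscillating \<Delta> \<mu> f u \<longleftrightarrow>
     limsup (\<lambda>N::nat. ereal (gamma \<Delta> \<mu> f u (vec (- real N)) (2 * real N))) < 1"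

definition max_on_ball :: "(real^'n::finite \<Rightarrow> real) \<Rightarrow> real \<Rightarrow> real" where
  "max_on_ball u R = (SUP z\<in>ball 0 R. u z)"

end

theory Submission
  imports Defs
begin

text \<open>
  Call a ball crowded if rogue cubes fill at least a fixed proportion \<open>\<eta>\<close> of it. In a large ball that
  is not crowded the set where \<open>u\<close> is positive carries little \<open>\<mu>\<close>-mass: the rogue cubes and a thin
  boundary layer are controlled by \<open>\<psi>\<close>, the remaining cubes by \<open>\<Delta>\<close>. So the mean-value inequality
  makes the supremum over the ball much larger than the value at its centre, and together with the
  maximum principle the supremum over \<open>cball x \<rho>\<close> is multiplied by \<open>e\<close> when \<open>\<rho>\<close> grows by a suitable
  amount (\<open>growth_step\<close>). That amount is a constant unless the relevant point of the sphere lies in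
  one of the crowded balls, in which case it is comparable to the radius of that ball.

  By Vitali's lemma finitely many disjoint crowded balls with radii \<open>s\<close> represent all of them
  (\<open>crowded_ball_selection\<close>), and disjointness bounds the sum of all \<open>s ^ d\<close> by a multiple of the
  number of rogue cubes. Expanding spheres around a fixed point \<open>x\<close> meet each selected ball in at most
  one step. If the supremum grows by less than \<open>exp n\<close> between the radii \<open>r\<close> and \<open>2 * r\<close>, then steps
  shorter than \<open>r / (2 * n)\<close> cannot cover half of the way, and hence the selected balls near \<open>x\<close> with
  radii \<open>s\<close> of order at least \<open>r / n\<close> have radii of total length comparable to \<open>r\<close>
  (\<open>radial_growth\<close>).

  The power of the logarithm comes from doing this at all dyadic scales at once. If the supremum over
  the big ball is smaller than \<open>exp (n * J / 2)\<close>, then around each typical point at least half of \<open>J\<close>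
  consecutive dyadic scales \<open>r\<close> are slow in this sense. A selected ball of radius \<open>s\<close> pays \<open>s / r\<close> at
  the scale \<open>r\<close> to each point at distance at most of order \<open>r\<close>, but only for \<open>r\<close> of order at most
  \<open>n * s\<close>. Its total expense is a sum of terms \<open>s * r ^ (d - 1)\<close>, which is geometric because \<open>d \<ge> 2\<close>
  and so is of order \<open>n ^ (d - 1) * s ^ d\<close>, without a factor \<open>J\<close> (\<open>scale_charging\<close>). Hence
  \<open>J * N ^ d\<close> is at most of order \<open>n ^ (d - 1)\<close> times the number of rogue cubes
  in \<open>[-N, N] ^ d\<close> (\<open>sup_growth\<close>).

  It remains to optimise. With \<open>q = f R / R\<close> one takes \<open>J\<close> of order \<open>ln q\<close>, which is the number of
  dyadic scales between \<open>n\<close> and \<open>R\<close>, and \<open>n\<close> of order \<open>R * (J / q) powr (1 / (d - 1))\<close>; then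
  \<open>n * J\<close> has the order of the denominator in the theorem (\<open>exists_steps_and_scales\<close>). The smallness of
  \<open>c\<^sub>0\<close> makes typical points exist and guarantees that this \<open>n\<close> is at least 1.
\<close>

section \<open>Upper semi-continuous functions\<close>

lemma open_upper_semicontinuous_less:
  assumes "upper_semicontinuous u"
  shows "open {x. u x < c}"
proof (subst open_subopen, intro ballI)
  fix x assume "x \<in> {x. u x < c}"
  then have "\<forall>\<^sub>F y in nhds x. u y < c"
    using assms by (simp add: upper_semicontinuous_def)
  then show "\<exists>T. open T \<and> x \<in> T \<and> T \<subseteq> {x. u x < c}"
    by (auto simp: eventually_nhds)
qed

lemma upper_semicontinuous_borel:
  fixes u :: "'a::topological_space \<Rightarrow> real"
  assumes "upper_semicontinuous u"
  shows "u \<in> borel_measurable borel"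
  by (rule borel_measurableI_less) (simp add: borel_open open_upper_semicontinuous_less[OF assms])

lemma upper_semicontinuous_bdd_above:
  fixes u :: "'a::heine_borel \<Rightarrow> real"
  assumes "upper_semicontinuous u" "bounded K"
  shows "bdd_above (u ` K)"
proof -
  have "compact (closure K)"
    using assms(2) by simp
  moreover have "open {x. u x < real n}" for n
    by (rule open_upper_semicontinuous_less[OF assms(1)])
  moreover have "closure K \<subseteq> (\<Union>n\<in>(UNIV::nat set). {x. u x < real n})"
    using reals_Archimedean2 by auto
  ultimately obtain C where C: "finite C" "closure K \<subseteq> (\<Union>n\<in>C. {x. u x < real n})"
    by (rule compactE_image)
  have "u x \<le> real (Max C)" if x: "x \<in> K" for x
  proof -
    obtain n where n: "n \<in> C" "u x < real n"
      using x C(2) closure_subset[of K] by blast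
    then show ?thesis
      using Max_ge[OF C(1) n(1)] by linarith
  qed
  then show ?thesis by (intro bdd_aboveI2)
qed

section \<open>Basic cubes and rogue cubes\<close>

text \<open>Indexing the cubes by their integer corners makes disjointness, covering and finiteness
  statements about the function that takes the floor of each coordinate.\<close>

definition unit_cube :: "('n::finite \<Rightarrow> int) \<Rightarrow> (real^'n) set" where
  "unit_cube k = {x. \<forall>j. of_int (k j) \<le> x $ j \<and> x $ j < of_int (k j) + 1}"

lemma basic_cubes_eq: "basic_cubes = range unit_cube"
  by (auto simp: basic_cubes_def unit_cube_def)

lemma in_unit_cube_iff: "x \<in> unit_cube k \<longleftrightarrow> k = (\<lambda>j. \<lfloor>x $ j\<rfloor>)"
  by (auto simp: unit_cube_def fun_eq_iff floor_eq_iff) (metis floor_unique)+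

lemma ex_basic_cube: "\<exists>I\<in>basic_cubes. x \<in> I"
  by (auto simp: basic_cubes_eq in_unit_cube_iff)

lemma basic_cubes_disjoint: "disjoint_family_on (\<lambda>I. I) basic_cubes"
  unfolding disjoint_family_on_def basic_cubes_eq by (auto simp: in_unit_cube_iff)

lemma unit_cube_borel: "unit_cube k \<in> sets borel"
  unfolding unit_cube_def by measurable

lemma basic_cube_borel: "I \<in> basic_cubes \<Longrightarrow> I \<in> sets borel"
  by (auto simp: basic_cubes_eq unit_cube_borel)

lemma emeasure_basic_cube_le:
  assumes "I \<in> basic_cubes"
  shows "emeasure lborel I \<le> 1"
proof -
  obtain k where I: "I = unit_cube k"
    using assms by (auto simp: basic_cubes_eq)
  let ?a = "\<chi> j. real_of_int (k j)" and ?b = "\<chi> j. real_of_int (k j) + 1"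
  have "I \<subseteq> cbox ?a ?b"
    unfolding I unit_cube_def mem_box_cart subset_eq by (simp add: mem_box_cart less_imp_le)
  then have "emeasure lborel I \<le> emeasure lborel (cbox ?a ?b)"
    by (intro emeasure_mono) auto
  also have "\<dots> = ennreal (measure lborel (cbox ?a ?b))"
    using emeasure_lborel_cbox_finite[of ?a ?b] by (intro emeasure_eq_ennreal_measure) auto
  also have "measure lborel (cbox ?a ?b) = 1"
    by (subst content_cbox_cart) (auto simp: interval_ne_empty_cart)
  finally show ?thesis by simp
qed

text \<open>The sum of the coordinate differences is a crude bound, but the sharp diameter \<open>sqrt d\<close> would
  only change constants.\<close>

lemma basic_cube_dist_le:
  fixes x y :: "real^'n"
  assumes "I \<in> basic_cubes" "x \<in> I" "y \<in> I"
  shows "dist x y \<le> CARD('n)"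
proof -
  obtain k where I: "I = unit_cube k"
    using assms by (auto simp: basic_cubes_eq)
  have "dist x y \<le> (\<Sum>j\<in>UNIV. \<bar>(x - y) $ j\<bar>)"
    unfolding dist_norm by (rule norm_le_l1_cart)
  also have "\<dots> \<le> (\<Sum>j\<in>(UNIV::'n set). 1)"
  proof (rule sum_mono)
    fix j
    have "of_int (k j) \<le> x $ j" "x $ j < of_int (k j) + 1" "of_int (k j) \<le> y $ j" "y $ j < of_int (k j) + 1"
      using assms(2,3) by (auto simp: I unit_cube_def)
    then show "\<bar>(x - y) $ j\<bar> \<le> 1" by simp
  qed
  finally show ?thesis by simp
qed

lemma finite_basic_cubes_in_bounded:
  fixes Q :: "(real^'n) set"
  assumes "bounded Q"
  shows "finite {I \<in> basic_cubes. I \<subseteq> Q}"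
proof -
  obtain b where b: "\<And>x. x \<in> Q \<Longrightarrow> norm x \<le> b"
    using assms by (auto simp: bounded_iff)
  have "finite (UNIV \<rightarrow>\<^sub>E {-\<lceil>b\<rceil>..\<lceil>b\<rceil>} :: ('n \<Rightarrow> int) set)"
    by (intro finite_PiE) auto
  moreover have "{I \<in> basic_cubes. I \<subseteq> Q} \<subseteq> unit_cube ` (UNIV \<rightarrow>\<^sub>E {-\<lceil>b\<rceil>..\<lceil>b\<rceil>})"
  proof
    fix I assume I: "I \<in> {I \<in> basic_cubes. I \<subseteq> Q}"
    then obtain k where k: "I = unit_cube k"
      by (auto simp: basic_cubes_eq)
    let ?x = "\<chi> j. real_of_int (k j)"
    have "?x \<in> Q"
      using I by (auto simp: k unit_cube_def)
    then have "\<bar>real_of_int (k j)\<bar> \<le> b" for j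
      using b[of ?x] component_le_norm_cart[of ?x j] by simp
    then have "k j \<in> {-\<lceil>b\<rceil>..\<lceil>b\<rceil>}" for j
      by (smt (verit) atLeastAtMost_iff le_of_int_ceiling of_int_le_iff of_int_minus)
    then show "I \<in> unit_cube ` (UNIV \<rightarrow>\<^sub>E {-\<lceil>b\<rceil>..\<lceil>b\<rceil>})"
      by (auto simp: k)
  qed
  ultimately show ?thesis
    by (meson finite_imageI finite_subset)
qed

definition rogue_cubes ::
  "real \<Rightarrow> (real^'n::finite) measure \<Rightarrow> (real^'n \<Rightarrow> real) \<Rightarrow> (real^'n) set \<Rightarrow> (real^'n) set set" where
  "rogue_cubes \<Delta> \<mu> u Q = {I \<in> basic_cubes. I \<subseteq> Q \<and> \<not> oscillates_in \<Delta> \<mu> u I}"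

lemma finite_rogue_cubes: "bounded Q \<Longrightarrow> finite (rogue_cubes \<Delta> \<mu> u Q)"
  unfolding rogue_cubes_def by (rule finite_subset[OF _ finite_basic_cubes_in_bounded]) auto

lemma rogue_region_borel:
  "bounded Q \<Longrightarrow> \<Union> (rogue_cubes \<Delta> \<mu> u Q) \<in> sets borel"
  by (intro sets.finite_Union finite_rogue_cubes) (auto simp: rogue_cubes_def basic_cube_borel)

lemma rogue_region_measure_le:
  assumes "bounded Q"
  shows "emeasure lborel (\<Union> (rogue_cubes \<Delta> \<mu> u Q)) \<le> real (card (rogue_cubes \<Delta> \<mu> u Q))"
proof -
  let ?C = "rogue_cubes \<Delta> \<mu> u Q"
  have "emeasure lborel (\<Union>I\<in>?C. I) \<le> (\<Sum>I\<in>?C. emeasure lborel I)"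
    by (intro emeasure_subadditive_finite finite_rogue_cubes assms)
       (auto simp: rogue_cubes_def basic_cube_borel)
  also have "\<dots> \<le> (\<Sum>I\<in>?C. 1)"
    by (intro sum_mono emeasure_basic_cube_le) (auto simp: rogue_cubes_def)
  finally show ?thesis by (simp add: ennreal_of_nat_eq_real_of_nat)
qed

section \<open>Growth over a single ball\<close>

text \<open>The set \<open>U\<close> will be the union of the rogue cubes. It is kept arbitrary because the covering
  arguments below use only its measure.\<close>

definition crowded :: "real \<Rightarrow> 'a::euclidean_space set \<Rightarrow> 'a \<Rightarrow> real \<Rightarrow> bool" where
  "crowded \<eta> U z t \<longleftrightarrow> \<eta> * measure lborel (ball z t) \<le> measure lborel (U \<inter> ball z t)"

lemma content_ball_cart:
  "0 \<le> r \<Longrightarrow> measure lborel (ball (c::real^'n) r) = unit_ball_vol (CARD('n)) * r ^ CARD('n)"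
  by (simp add: content_ball)

lemma ball_fmeasurable: "ball c r \<in> fmeasurable lborel"
  using emeasure_lborel_ball_finite[of c r] by (auto simp: fmeasurable_def)

lemma integrable_ball_indicator: "integrable lborel (indicat_real (ball c r))"
  using ball_fmeasurable[of c r] by (intro integrable_real_indicator) (auto simp: fmeasurable_def)

text \<open>A point of the ball where \<open>u\<close> is positive lies in a rogue cube, or in a cube that sticks out of
  the ball and hence within distance \<open>d\<close> of its boundary, or in an oscillating cube inside the ball.
  The first two kinds form a set of relative Lebesgue measure at most \<open>2 * \<eta>\<close>, so its relative
  \<open>\<mu>\<close>-measure is at most \<open>\<psi> (2 * \<eta>)\<close>. In the third kind of cube (P2) leaves the positive
  part at most a proportion \<open>\<Delta>\<close> of the mass, and the cubes are disjoint. Controlling the boundary layer by \<open>\<psi>\<close> as well avoids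
  comparing the measures of concentric balls.\<close>

lemma measure_positive_part_le:
  fixes u :: "real^'n \<Rightarrow> real"
  assumes \<mu>: "\<mu> \<in> M_class \<psi>" and usc: "upper_semicontinuous u"
    and mono: "mono_on {0..1} \<psi>" and \<psi>: "\<psi> (2 * \<eta>) \<le> \<Delta>" and \<eta>: "0 < \<eta>" "2 * \<eta> \<le> 1"
    and l: "0 < l" "(CARD('n))\<^sup>2 / \<eta> \<le> l" and Q: "bounded Q" "ball z l \<subseteq> Q"
    and free: "\<not> crowded \<eta> (\<Union> (rogue_cubes \<Delta> \<mu> u Q)) z l" and \<Delta>: "0 \<le> \<Delta>"
  shows "measure \<mu> (ball z l \<inter> {x. 0 < u x}) \<le> 2 * \<Delta> * measure \<mu> (ball z l)"
proof -
  let ?d = "real CARD('n)" and ?U = "\<Union> (rogue_cubes \<Delta> \<mu> u Q)" and ?B = "ball z l"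
  let ?P = "{x. 0 < u x}"
  have u[measurable]: "u \<in> borel_measurable borel"
    by (rule upper_semicontinuous_borel[OF usc])
  have sets: "sets \<mu> = sets borel"
    using \<mu> by (auto simp: M_class_def)
  have fin: "emeasure \<mu> ?B < \<infinity>" and pos: "0 < emeasure \<mu> ?B"
    using \<mu> l by (auto simp: M_class_def)
  have finS: "emeasure \<mu> S < \<infinity>" if "S \<subseteq> ?B" for S
    by (rule le_less_trans[OF emeasure_mono[OF that] fin]) (simp add: sets)
  have fm: "S \<in> fmeasurable \<mu>" if "S \<in> sets borel" "S \<subseteq> ?B" for S
    using that finS by (auto simp: fmeasurable_def sets)
  have posm: "0 < measure \<mu> ?B"
    using pos fin by (auto simp: measure_def enn2real_positive_iff)
  have [measurable]: "?U \<in> sets borel" by (rule rogue_region_borel[OF Q(1)])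
  have Pb[measurable]: "?P \<in> sets borel" by measurable
  (* E collects the two kinds of points that are controlled through Lebesgue measure. *)
  define E where "E = ?U \<inter> ?B \<union> (?B - ball z (l - ?d))"
  have Eb[measurable]: "E \<in> sets borel" unfolding E_def by measurable
  have EB: "E \<subseteq> ?B" by (auto simp: E_def)
  have d1: "1 \<le> ?d" by (simp add: Suc_leI)
  have "\<eta> \<le> ?d" using \<eta> d1 by linarith
  then have "?d * 1 \<le> ?d * (?d / \<eta>)"
    using \<eta> by (intro mult_left_mono) (auto simp: field_simps)
  then have d_le: "?d \<le> l" using l by (simp add: power2_eq_square)
  let ?v = "unit_ball_vol ?d"
  have v: "0 < ?v" by simp
  have lebE: "measure lborel E \<le> 2 * \<eta> * measure lborel ?B"
  proof -
    have "measure lborel E \<le> measure lborel (?U \<inter> ?B) + measure lborel (?B - ball z (l - ?d))"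
      unfolding E_def by (intro measure_Un_le) auto
    also have "measure lborel (?B - ball z (l - ?d)) = measure lborel ?B - measure lborel (ball z (l - ?d))"
      using emeasure_lborel_ball_finite[of z l] by (intro measure_Diff) (auto simp: subset_ball)
    also have "\<dots> \<le> \<eta> * measure lborel ?B"
    proof -
      (* The boundary layer has relative measure 1 - (1 - d / l) ^ d, at most d^2 / l by Bernoulli. *)
      have "l ^ CARD('n) * (1 + real CARD('n) * (- ?d / l)) \<le> l ^ CARD('n) * (1 + - ?d / l) ^ CARD('n)"
        using d_le l(1) by (intro mult_left_mono Bernoulli_inequality) (auto simp: field_simps)
      also have "\<dots> = (l - ?d) ^ CARD('n)"
        using l(1) by (simp add: power_mult_distrib[symmetric] algebra_simps)
      finally have 1: "l ^ CARD('n) * (1 + real CARD('n) * (- ?d / l)) \<le> (l - ?d) ^ CARD('n)" .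
      have "?d\<^sup>2 / l \<le> \<eta>"
        using l \<eta> by (simp add: field_simps)
      then have "l ^ CARD('n) * (1 - \<eta>) \<le> l ^ CARD('n) * (1 + real CARD('n) * (- ?d / l))"
        using l(1) by (intro mult_left_mono) (auto simp: power2_eq_square)
      with 1 have "l ^ CARD('n) - (l - ?d) ^ CARD('n) \<le> \<eta> * l ^ CARD('n)"
        by (simp add: algebra_simps)
      then have "?v * (l ^ CARD('n) - (l - ?d) ^ CARD('n)) \<le> ?v * (\<eta> * l ^ CARD('n))"
        using v by (intro mult_left_mono) auto
      then show ?thesis
        using l d_le by (simp add: content_ball_cart algebra_simps)
    qed
    also have "measure lborel (?U \<inter> ?B) \<le> \<eta> * measure lborel ?B"
      using free by (simp add: crowded_def)
    finally show ?thesis by simp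
  qed
  have lebB: "0 < measure lborel ?B"
    using l v by (simp add: content_ball_cart)
  have muE: "measure \<mu> E \<le> \<Delta> * measure \<mu> ?B"
  proof -
    have "measure \<mu> E / measure \<mu> ?B \<le> \<psi> (measure lborel E / measure lborel ?B)"
      using \<mu> l Eb EB by (auto simp: M_class_def)
    also have "\<dots> \<le> \<psi> (2 * \<eta>)"
    proof -
      have "measure lborel E / measure lborel ?B \<le> 2 * \<eta>"
        using lebE lebB by (simp add: divide_le_eq)
      then show ?thesis
        using \<eta> by (intro mono_onD[OF mono]) auto
    qed
    finally have "measure \<mu> E / measure \<mu> ?B \<le> \<Delta>" using \<psi> by simp
    then show ?thesis using posm by (simp add: divide_le_eq)
  qed
  define G where "G = {I \<in> basic_cubes. I \<subseteq> ?B \<and> oscillates_in \<Delta> \<mu> u I}"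
  have G_fin: "finite G"
    unfolding G_def by (rule finite_subset[OF _ finite_basic_cubes_in_bounded[OF bounded_ball]]) auto
  have G_borel: "I \<in> sets borel" if "I \<in> G" for I
    using that by (simp add: G_def basic_cube_borel)
  have G_B: "I \<subseteq> ?B" if "I \<in> G" for I
    using that by (simp add: G_def)
  have GP: "(\<Union>I\<in>G. I \<inter> ?P) \<in> sets borel"
    using G_fin G_borel Pb by (intro sets.finite_UN sets.Int) auto
  have cover: "?B \<inter> ?P \<subseteq> E \<union> (\<Union>I\<in>G. I \<inter> ?P)"
  proof
    fix y assume y: "y \<in> ?B \<inter> ?P"
    obtain I where I: "I \<in> basic_cubes" "y \<in> I"
      using ex_basic_cube by blast
    consider "I \<subseteq> ?B" "oscillates_in \<Delta> \<mu> u I" | "I \<subseteq> ?B" "\<not> oscillates_in \<Delta> \<mu> u I" | "\<not> I \<subseteq> ?B"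
      by blast
    then show "y \<in> E \<union> (\<Union>I\<in>G. I \<inter> ?P)"
    proof cases
      case 1
      then show ?thesis using I y by (auto simp: G_def)
    next
      case 2
      then have "I \<in> rogue_cubes \<Delta> \<mu> u Q"
        using I Q by (auto simp: rogue_cubes_def)
      then show ?thesis using I y by (auto simp: E_def)
    next
      case 3
      then obtain w where "w \<in> I" "w \<notin> ball z l" by blast
      then have w: "w \<in> I" "l \<le> dist z w" by auto
      have "dist z w \<le> dist z y + dist y w" by (rule dist_triangle)
      with w basic_cube_dist_le[OF I(1) I(2) w(1)] have "l - ?d \<le> dist z y" by simp
      then show ?thesis using y by (auto simp: E_def)
    qed
  qed
  have osc: "measure \<mu> (I \<inter> ?P) \<le> \<Delta> * measure \<mu> I" if I: "I \<in> G" for I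
  proof (cases "measure \<mu> I = 0")
    case True
    have "measure \<mu> (I \<inter> ?P) \<le> measure \<mu> I"
      using G_borel[OF I] G_B[OF I] by (intro measure_mono_fmeasurable fm) (auto simp: sets)
    then show ?thesis using True by simp
  next
    case False
    then have "0 < measure \<mu> I" by (simp add: zero_less_measure_iff)
    moreover have "1 - \<Delta> \<le> measure \<mu> (I \<inter> {x. u x \<le> 0}) / measure \<mu> I"
      using I by (auto simp: G_def oscillates_in_def)
    ultimately have "(1 - \<Delta>) * measure \<mu> I \<le> measure \<mu> (I \<inter> {x. u x \<le> 0})"
      by (simp add: field_simps)
    moreover have "measure \<mu> (I - I \<inter> {x. u x \<le> 0}) = measure \<mu> I - measure \<mu> (I \<inter> {x. u x \<le> 0})"
      using finS[OF G_B[OF I]] G_borel[OF I] by (intro measure_Diff) (auto simp: sets)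
    moreover have "I - I \<inter> {x. u x \<le> 0} = I \<inter> ?P" by auto
    ultimately show ?thesis by (simp add: algebra_simps)
  qed
  have "measure \<mu> (?B \<inter> ?P) \<le> measure \<mu> (E \<union> (\<Union>I\<in>G. I \<inter> ?P))"
    using Eb GP EB G_B by (intro measure_mono_fmeasurable[OF cover] fm sets.Un) (auto simp: sets)
  also have "\<dots> \<le> measure \<mu> E + measure \<mu> (\<Union>I\<in>G. I \<inter> ?P)"
    using GP by (intro measure_Un_le) (auto simp: sets)
  also have "measure \<mu> (\<Union>I\<in>G. I \<inter> ?P) \<le> (\<Sum>I\<in>G. measure \<mu> (I \<inter> ?P))"
    using G_fin G_borel by (intro measure_UNION_le) (auto simp: sets)
  also have "\<dots> \<le> (\<Sum>I\<in>G. \<Delta> * measure \<mu> I)"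
    by (intro sum_mono osc)
  also have "\<dots> = \<Delta> * (\<Sum>I\<in>G. measure \<mu> I)"
    by (simp add: sum_distrib_left)
  also have "(\<Sum>I\<in>G. measure \<mu> I) = measure \<mu> (\<Union>I\<in>G. I)"
  proof (rule measure_finite_Union[symmetric, OF G_fin])
    show "disjoint_family_on (\<lambda>I. I) G"
      by (rule disjoint_family_on_mono[OF _ basic_cubes_disjoint]) (auto simp: G_def)
  qed (use G_borel G_B finS in \<open>auto simp: sets less_top[symmetric]\<close>)
  also have "\<Delta> * measure \<mu> (\<Union>I\<in>G. I) \<le> \<Delta> * measure \<mu> ?B"
    using G_fin G_borel G_B \<Delta>
    by (intro mult_left_mono measure_mono_fmeasurable fm) (auto simp: sets)
  finally show ?thesis using muE by simp
qed

text \<open>In the mean-value inequality the set where \<open>u \<le> 0\<close> contributes nothing positive, and on its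
  complement \<open>u\<close> is at most its supremum.\<close>

lemma mean_value_gain:
  fixes u :: "real^'n \<Rightarrow> real"
  assumes \<mu>: "\<mu> \<in> M_class \<psi>" and u: "u \<in> F_class r\<^sub>0 A B \<mu>" and B: "0 \<le> B"
    and l: "0 < l" "r\<^sub>0 < l"
    and small: "measure \<mu> (ball z l \<inter> {x. 0 < u x}) \<le> \<epsilon> * measure \<mu> (ball z l)"
    and pos: "0 < u z"
  shows "u z \<le> B * \<epsilon> * (SUP y\<in>ball z l. u y)"
proof -
  let ?B = "ball z l" and ?P = "{x. 0 < u x}"
  let ?S = "SUP y\<in>?B. u y"
  have usc: "upper_semicontinuous u" using u by (simp add: F_class_def)
  have [measurable]: "u \<in> borel_measurable borel"
    by (rule upper_semicontinuous_borel[OF usc])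
  have sets: "sets \<mu> = sets borel"
    using \<mu> by (auto simp: M_class_def)
  have "emeasure \<mu> ?B < \<infinity>" "0 < emeasure \<mu> ?B"
    using \<mu> l by (auto simp: M_class_def)
  then have posm: "0 < measure \<mu> ?B" and fin: "emeasure \<mu> (?B \<inter> ?P) < \<infinity>"
    by (auto simp: measure_def enn2real_positive_iff sets intro: le_less_trans[OF emeasure_mono])
  have le_S: "u y \<le> ?S" if "y \<in> ?B" for y
    using that by (intro cSUP_upper upper_semicontinuous_bdd_above[OF usc]) auto
  have S: "0 \<le> ?S" using le_S[of z] pos l by simp
  have int: "set_integrable \<mu> ?B u"
    and mv: "u z \<le> B * (1 / measure \<mu> ?B * (LINT y:?B|\<mu>. u y))"
    using u l by (auto simp: F_class_def)
  have "(LINT y:?B|\<mu>. u y) \<le> (LINT y|\<mu>. ?S * indicator (?B \<inter> ?P) y)"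
    unfolding set_lebesgue_integral_def
  proof (rule integral_mono)
    show "integrable \<mu> (\<lambda>y. indicat_real ?B y *\<^sub>R u y)"
      using int by (simp add: set_integrable_def)
    show "integrable \<mu> (\<lambda>y. ?S * indicat_real (?B \<inter> ?P) y)"
      using fin by (intro integrable_mult_right integrable_real_indicator) (auto simp: sets)
    fix y
    show "indicat_real ?B y *\<^sub>R u y \<le> ?S * indicat_real (?B \<inter> ?P) y"
      using le_S[of y] by (auto simp: indicator_def)
  qed
  also have "\<dots> = ?S * measure \<mu> (?B \<inter> ?P)"
    by (simp add: sets)
  also have "\<dots> \<le> ?S * (\<epsilon> * measure \<mu> ?B)"
    by (rule mult_left_mono[OF small S])
  finally have "1 / measure \<mu> ?B * (LINT y:?B|\<mu>. u y) \<le> \<epsilon> * ?S"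
    using posm by (simp add: field_simps)
  from mult_left_mono[OF this B] mv show ?thesis by (simp add: mult.assoc)
qed

text \<open>The factor 2 replaces an argument that the supremum over the sphere is attained.\<close>

lemma max_principle_sphere:
  fixes u :: "real^'n \<Rightarrow> real"
  assumes u: "u \<in> F_class r\<^sub>0 A B \<mu>" and A: "1 \<le> A" and \<rho>: "0 \<le> \<rho>"
    and pos: "0 < (SUP y\<in>cball x \<rho>. u y)"
  shows "\<exists>z. dist x z = \<rho> \<and> (SUP y\<in>cball x \<rho>. u y) \<le> 2 * A * u z"
proof (rule ccontr)
  let ?S = "SUP y\<in>cball x \<rho>. u y" and ?T = "SUP y\<in>sphere x \<rho>. u y"
  assume neg: "\<not> ?thesis"
  have "(SUP y\<in>K. u y) \<le> A * (SUP y\<in>frontier K. u y)" if "K \<noteq> {}" "bounded K" "convex K" for K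
    using that u unfolding F_class_def by blast
  from this[of "cball x \<rho>"] have ST: "?S \<le> A * ?T"
    using \<rho> by simp
  have "?T \<le> ?S / (2 * A)"
  proof (rule cSUP_least)
    show "sphere x \<rho> \<noteq> {}" using \<rho> by simp
    fix z assume "z \<in> sphere x \<rho>"
    then have "2 * A * u z < ?S" using neg by (auto simp: not_le)
    then show "u z \<le> ?S / (2 * A)" using A by (simp add: field_simps)
  qed
  then have "A * ?T \<le> A * (?S / (2 * A))" using A by (intro mult_left_mono) auto
  then show False using ST pos A by simp
qed

text \<open>The maximum principle moves the supremum to a point \<open>z\<close> of the sphere at the price of a factor
  \<open>2 * A\<close>, and the mean-value inequality on \<open>ball z l\<close> gains \<open>1 / (2 * B * \<Delta>)\<close>. The condition on \<open>\<Delta>\<close>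
  makes the product at least \<open>3\<close>, which exceeds \<open>exp 1\<close>. The point \<open>z\<close> is chosen before the
  radius \<open>l\<close>, so that the radius can be adapted to the crowded balls around \<open>z\<close>.\<close>

lemma growth_step:
  fixes u :: "real^'n \<Rightarrow> real"
  assumes \<mu>: "\<mu> \<in> M_class \<psi>" and u: "u \<in> F_class r\<^sub>0 A B \<mu>" and AB: "1 \<le> A" "1 \<le> B"
    and mono: "mono_on {0..1} \<psi>" and \<psi>: "\<psi> (2 * \<eta>) \<le> \<Delta>" and \<eta>: "0 < \<eta>" "2 * \<eta> \<le> 1"
    and \<Delta>: "0 < \<Delta>" "12 * A * B * \<Delta> \<le> 1"
    and \<tau>: "0 < \<tau>" "r\<^sub>0 < \<tau>" "(CARD('n))\<^sup>2 / \<eta> \<le> \<tau>" and Q: "bounded Q"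
    and \<rho>: "0 \<le> \<rho>" and pos: "0 < (SUP y\<in>cball x \<rho>. u y)"
  shows "\<exists>z. dist x z = \<rho> \<and> (\<forall>l\<ge>\<tau>. cball x (\<rho> + l) \<subseteq> Q \<longrightarrow>
           \<not> crowded \<eta> (\<Union> (rogue_cubes \<Delta> \<mu> u Q)) z l \<longrightarrow>
           exp 1 * (SUP y\<in>cball x \<rho>. u y) \<le> (SUP y\<in>cball x (\<rho> + l). u y))"
proof -
  let ?S = "\<lambda>\<rho>. SUP y\<in>cball x \<rho>. u y"
  have usc: "upper_semicontinuous u" using u by (simp add: F_class_def)
  obtain z where z: "dist x z = \<rho>" "?S \<rho> \<le> 2 * A * u z"
    using max_principle_sphere[OF u AB(1) \<rho> pos] by blast
  have uz: "0 < u z"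
    using z(2) pos AB by (smt (verit) mult_nonneg_nonpos)
  have "exp 1 * ?S \<rho> \<le> ?S (\<rho> + l)"
    if l: "\<tau> \<le> l" "cball x (\<rho> + l) \<subseteq> Q" "\<not> crowded \<eta> (\<Union> (rogue_cubes \<Delta> \<mu> u Q)) z l" for l
  proof -
    have sub: "ball z l \<subseteq> cball x (\<rho> + l)"
    proof
      fix y assume "y \<in> ball z l"
      then show "y \<in> cball x (\<rho> + l)" using dist_triangle[of x y z] z(1) by simp
    qed
    have "measure \<mu> (ball z l \<inter> {x. 0 < u x}) \<le> 2 * \<Delta> * measure \<mu> (ball z l)"
      using l \<tau> \<Delta> sub by (intro measure_positive_part_le[OF \<mu> usc mono \<psi> \<eta> _ _ Q]) auto
    then have "u z \<le> B * (2 * \<Delta>) * (SUP y\<in>ball z l. u y)"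
      using l \<tau> AB by (intro mean_value_gain[OF \<mu> u _ _ _ _ uz]) auto
    also have "\<dots> \<le> B * (2 * \<Delta>) * ?S (\<rho> + l)"
      using AB \<Delta> l \<tau> sub
      by (intro mult_left_mono cSUP_subset_mono upper_semicontinuous_bdd_above[OF usc]) auto
    finally have "6 * A * u z \<le> 6 * A * (B * (2 * \<Delta>) * ?S (\<rho> + l))"
      using AB by (intro mult_left_mono) auto
    also have "\<dots> = (12 * A * B * \<Delta>) * ?S (\<rho> + l)" by simp
    also have "\<dots> \<le> 1 * ?S (\<rho> + l)"
    proof (rule mult_right_mono[OF \<Delta>(2)])
      have "u z \<le> ?S (\<rho> + l)"
        using z(1) l \<tau> by (intro cSUP_upper upper_semicontinuous_bdd_above[OF usc]) auto
      then show "0 \<le> ?S (\<rho> + l)" using uz by simp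
    qed
    finally have "3 * ?S \<rho> \<le> ?S (\<rho> + l)" using z(2) by simp
    moreover have "exp 1 * ?S \<rho> \<le> 3 * ?S \<rho>"
      using pos exp_le by (intro mult_right_mono) auto
    ultimately show ?thesis by simp
  qed
  then show ?thesis using z(1) by blast
qed

section \<open>Passing between crowded balls\<close>

text \<open>The crowded balls have bounded radii because \<open>U\<close> has finite measure, so Vitali's lemma applies.
  Each selected ball contains a fixed proportion of its volume in \<open>U\<close>, and these parts are disjoint. This
  bounds the sum of the volumes, and as no radius is below \<open>\<tau>\<close>, it also bounds the number of balls.\<close>

lemma crowded_ball_selection:
  fixes U :: "'a::euclidean_space set"
  assumes U: "U \<in> sets borel" "emeasure lborel U \<le> ennreal P" and P: "0 \<le> P"
    and \<eta>: "0 < \<eta>" and \<tau>: "0 < \<tau>"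
  obtains D where "finite D" "\<And>c s. (c, s) \<in> D \<Longrightarrow> \<tau> \<le> s"
    "\<And>z t. \<tau> \<le> t \<Longrightarrow> crowded \<eta> U z t \<Longrightarrow> \<exists>(c, s)\<in>D. z \<in> ball c (5 * s) \<and> t \<le> 5 * s"
    "\<eta> * unit_ball_vol DIM('a) * (\<Sum>(c, s)\<in>D. s ^ DIM('a)) \<le> P"
proof -
  let ?v = "unit_ball_vol DIM('a)"
  have v: "0 < ?v" by simp
  have Ufin: "emeasure lborel U < \<infinity>"
    using U(2) by (simp add: le_less_trans)
  have Ule: "measure lborel S \<le> P" if "S \<subseteq> U" for S
  proof -
    have "emeasure lborel S \<le> ennreal P"
      using emeasure_mono[OF that, of lborel] U by simp
    then show ?thesis
      using P by (simp add: measure_def enn2real_leI)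
  qed
  have fm: "U \<inter> cball c s \<in> fmeasurable lborel" for c s
    using U le_less_trans[OF emeasure_mono[of "U \<inter> cball c s" U lborel] Ufin]
    by (auto simp: fmeasurable_def)
  have crowded_le: "\<eta> * ?v * t ^ DIM('a) \<le> measure lborel (U \<inter> cball z t)"
    if "\<tau> \<le> t" "crowded \<eta> U z t" for z t
  proof -
    have "\<eta> * ?v * t ^ DIM('a) \<le> measure lborel (U \<inter> ball z t)"
      using that \<tau> by (simp add: crowded_def content_ball mult.assoc)
    also have "\<dots> \<le> measure lborel (U \<inter> cball z t)"
      using U by (intro measure_mono_fmeasurable fm) auto
    finally show ?thesis .
  qed
  define K where "K = {(c, s). \<tau> \<le> s \<and> crowded \<eta> U c s}"
  (* A radius above 1 is at most its DIM-th power, which avoids taking a root. *)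
  define b where "b = max 1 (P / (\<eta> * ?v))"
  have radius: "0 < snd i \<and> snd i \<le> b" if i: "i \<in> K" for i
  proof
    obtain c s where cs: "i = (c, s)" "\<tau> \<le> s" "crowded \<eta> U c s"
      using i by (auto simp: K_def)
    show "0 < snd i" using cs \<tau> by simp
    have "\<eta> * ?v * s ^ DIM('a) \<le> P"
      using crowded_le[OF cs(2,3)] Ule[of "U \<inter> cball c s"] by simp
    then have "s ^ DIM('a) \<le> P / (\<eta> * ?v)"
      using \<eta> v by (simp add: field_simps)
    moreover have "s \<le> s ^ DIM('a)" if "1 \<le> s"
      using that by (intro self_le_power) auto
    ultimately show "snd i \<le> b" using cs(1) unfolding b_def by (cases "1 \<le> s") auto
  qed
  obtain D where D: "countable D" "D \<subseteq> K"
      and disj: "pairwise (\<lambda>i j. disjnt (cball (fst i) (snd i)) (cball (fst j) (snd j))) D"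
      and cov: "\<And>i. i \<in> K \<Longrightarrow> \<exists>j. j \<in> D \<and> \<not> disjnt (cball (fst i) (snd i)) (cball (fst j) (snd j)) \<and>
                  cball (fst i) (snd i) \<subseteq> ball (fst j) (5 * snd j)"
    using Vitali_covering_lemma_cballs_balls[of K snd b fst] radius by blast
  have sum_le: "\<eta> * ?v * (\<Sum>i\<in>F. snd i ^ DIM('a)) \<le> P" if F: "finite F" "F \<subseteq> D" for F
  proof -
    have "\<eta> * ?v * (\<Sum>i\<in>F. snd i ^ DIM('a)) = (\<Sum>i\<in>F. \<eta> * ?v * snd i ^ DIM('a))"
      by (simp add: sum_distrib_left)
    also have "\<dots> \<le> (\<Sum>i\<in>F. measure lborel (U \<inter> cball (fst i) (snd i)))"
      using F D by (intro sum_mono crowded_le) (auto simp: K_def)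
    also have "\<dots> = measure lborel (\<Union>i\<in>F. U \<inter> cball (fst i) (snd i))"
    proof (rule measure_finite_Union[symmetric, OF F(1)])
      show "disjoint_family_on (\<lambda>i. U \<inter> cball (fst i) (snd i)) F"
        unfolding disjoint_family_on_def
      proof (intro ballI impI)
        fix i j assume "i \<in> F" "j \<in> F" "i \<noteq> j"
        then have "disjnt (cball (fst i) (snd i)) (cball (fst j) (snd j))"
          using disj F by (auto simp: pairwise_def subset_eq)
        then show "U \<inter> cball (fst i) (snd i) \<inter> (U \<inter> cball (fst j) (snd j)) = {}"
          by (auto simp: disjnt_def)
      qed
    qed (use U fm in \<open>auto simp: fmeasurable_def less_top[symmetric]\<close>)
    also have "\<dots> \<le> P" by (rule Ule) auto
    finally show ?thesis .
  qed
  have Dge: "\<tau> \<le> snd i" if "i \<in> D" for i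
    using that D(2) by (auto simp: K_def)
  have "finite D"
  proof -
    have "card F \<le> nat \<lceil>P / (\<eta> * ?v * \<tau> ^ DIM('a))\<rceil>" if F: "finite F" "F \<subseteq> D" for F
    proof -
      have "\<eta> * ?v * (\<Sum>i\<in>F. \<tau> ^ DIM('a)) \<le> \<eta> * ?v * (\<Sum>i\<in>F. snd i ^ DIM('a))"
        using F Dge \<eta> v \<tau> by (intro mult_left_mono sum_mono power_mono) (auto simp: subset_eq)
      also have "\<dots> \<le> P" by (rule sum_le[OF F])
      finally have "real (card F) \<le> P / (\<eta> * ?v * \<tau> ^ DIM('a))"
        using \<eta> v \<tau> by (simp add: field_simps)
      then show ?thesis by linarith
    qed
    then show ?thesis by (rule finite_if_finite_subsets_card_bdd[rule_format, THEN conjunct1]) blast+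
  qed
  moreover have "\<exists>(c, s)\<in>D. z \<in> ball c (5 * s) \<and> t \<le> 5 * s" if t: "\<tau> \<le> t" "crowded \<eta> U z t" for z t
  proof -
    have "(z, t) \<in> K" using t by (simp add: K_def)
    from cov[OF this] obtain j where j: "j \<in> D" "cball z t \<subseteq> ball (fst j) (5 * snd j)" by auto
    have "z \<in> ball (fst j) (5 * snd j)" using t \<tau> by (intro subsetD[OF j(2)]) simp
    moreover have "t \<le> 5 * snd j"
    proof -
      have "dist z (fst j) + t < 5 * snd j"
        using j(2) t \<tau> by (auto simp: cball_subset_ball_iff)
      then show ?thesis using zero_le_dist[of z "fst j"] by linarith
    qed
    ultimately show ?thesis using j(1) by (intro bexI[of _ j]) (auto simp: case_prod_beta)
  qed
  moreover have "\<eta> * ?v * (\<Sum>(c, s)\<in>D. s ^ DIM('a)) \<le> P"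
    using sum_le[OF \<open>finite D\<close> order_refl] by (simp add: case_prod_beta)
  ultimately show thesis
    using that[of D] Dge by force
qed

text \<open>The point \<open>x\<close> is the centre of expanding spheres and \<open>S \<rho>\<close> is a supremum over the ball of radius
  \<open>\<rho>\<close>. From a point \<open>z\<close> on a sphere one advances by \<open>10 * s\<close>, where \<open>ball c (5 * s)\<close> is the
  largest of the enlarged selected balls around \<open>z\<close>: if \<open>(z, 10 * s)\<close> were crowded, then \<open>z\<close> would
  belong to an enlarged selected ball of at least twice the size. If there is no selected ball around
  \<open>z\<close>, one advances by \<open>\<tau>\<close>. A step of length \<open>10 * s\<close> swallows \<open>ball c (5 * s)\<close> completely, so the
  long steps use different selected balls. Hence \<open>n\<close> steps of length at most \<open>h\<close> fit as soon as all long
  steps together leave enough room for them.\<close>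

lemma radial_growth:
  fixes S :: "real \<Rightarrow> real" and D :: "('a::metric_space \<times> real) set" and C :: "'a \<Rightarrow> real \<Rightarrow> bool"
  assumes fin: "finite D" and D: "\<And>c s. (c, s) \<in> D \<Longrightarrow> \<tau> \<le> s" and \<tau>: "0 < \<tau>" "\<tau> \<le> h"
    and cover: "\<And>z t. \<tau> \<le> t \<Longrightarrow> C z t \<Longrightarrow> \<exists>(c, s)\<in>D. z \<in> ball c (5 * s) \<and> t \<le> 5 * s"
    and step: "\<And>\<rho>. r \<le> \<rho> \<Longrightarrow> \<rho> \<le> r' \<Longrightarrow> 0 < S \<rho> \<Longrightarrow>
      \<exists>z. dist x z = \<rho> \<and> (\<forall>l\<ge>\<tau>. \<rho> + l \<le> r' \<longrightarrow> \<not> C z l \<longrightarrow> exp 1 * S \<rho> \<le> S (\<rho> + l))"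
    and mono: "\<And>\<rho>. r \<le> \<rho> \<Longrightarrow> \<rho> \<le> r' \<Longrightarrow> S \<rho> \<le> S r'"
    and pos: "0 < S r"
    and room: "r + real n * h + (\<Sum>(c, s)\<in>{(c, s)\<in>D. h < 10 * s \<and> dist x c < r' + 5 * s}. 10 * s) \<le> r'"
  shows "exp (real n) * S r \<le> S r'"
proof -
  (* F \<rho> are the balls that long steps from radius \<rho> on can still use, and W \<rho> is the length of
     all these steps together. *)
  define F where "F \<rho> = {(c, s)\<in>D. h < 10 * s \<and> dist x c < r' + 5 * s \<and> (\<exists>w\<in>ball c (5 * s). \<rho> \<le> dist x w)}" for \<rho>
  define W where "W \<rho> = (\<Sum>(c, s)\<in>F \<rho>. 10 * s)" for \<rho>
  have finF: "finite (F \<rho>)" for \<rho>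
    unfolding F_def by (rule finite_subset[OF _ fin]) auto
  have Fnn: "0 \<le> (case b of (c, s) \<Rightarrow> 10 * s)" if "b \<in> D" for b
    using D that \<tau> by (cases b) force
  have FD: "F \<rho> \<subseteq> D" for \<rho> by (auto simp: F_def)
  have Wnn: "0 \<le> W \<rho>" for \<rho>
    unfolding W_def using FD by (intro sum_nonneg Fnn) auto
  have Fmono: "F \<rho>' \<subseteq> F \<rho>" if "\<rho> \<le> \<rho>'" for \<rho> \<rho>'
    unfolding F_def using that order_trans by blast
  have Wmono: "W \<rho>' \<le> W \<rho>" if "\<rho> \<le> \<rho>'" for \<rho> \<rho>'
    unfolding W_def
  proof (rule sum_mono2[OF finF])
    show "F \<rho>' \<subseteq> F \<rho>" by (rule Fmono[OF that])
  qed (use Fnn FD in blast)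
  (* A short step is paid by one of the m summands h, a long one by the ball that leaves F.
     Every step gains a factor e, so counting a long step as one of the m steps loses nothing. *)
  have main: "exp (real m) * S \<rho> \<le> S r'"
    if "r \<le> \<rho>" "0 < S \<rho>" "\<rho> + real m * h + W \<rho> \<le> r'" for m \<rho>
    using that
  proof (induction m arbitrary: \<rho>)
    case 0
    then show ?case using mono[of \<rho>] Wnn[of \<rho>] by simp
  next
    case (Suc m)
    have mh: "real (Suc m) * h = h + real m * h" by (simp add: algebra_simps)
    have mhn: "0 \<le> real m * h" using \<tau> by simp
    have "\<rho> \<le> r'" using Suc.prems(3) Wnn[of \<rho>] mh mhn \<tau> by linarith
    from step[OF Suc.prems(1) this Suc.prems(2)] obtain z where z: "dist x z = \<rho>"
      and zs: "\<And>l. \<tau> \<le> l \<Longrightarrow> \<rho> + l \<le> r' \<Longrightarrow> \<not> C z l \<Longrightarrow> exp 1 * S \<rho> \<le> S (\<rho> + l)"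
      by blast
    have "\<exists>l. \<tau> \<le> l \<and> \<not> C z l \<and> l + W (\<rho> + l) \<le> h + W \<rho>"
    proof (cases "\<exists>(c, s)\<in>D. z \<in> ball c (5 * s)")
      case False
      then have "\<not> C z \<tau>" using cover[of \<tau> z] by fastforce
      then show ?thesis using \<tau> Wmono[of \<rho> "\<rho> + \<tau>"] by (intro exI[of _ \<tau>]) auto
    next
      case True
      define E where "E = {(c, s)\<in>D. z \<in> ball c (5 * s)}"
      have E: "finite (snd ` E)" "snd ` E \<noteq> {}"
        using True fin by (auto simp: E_def intro: finite_subset[OF _ fin])
      obtain c s where cs: "(c, s) \<in> E" "s = Max (snd ` E)"
        using Max_in[OF E] by force
      have max: "s' \<le> s" if "(c', s') \<in> E" for c' s'
        unfolding cs(2) using that E by (intro Max_ge) force+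
      have csD: "(c, s) \<in> D" "dist c z < 5 * s" using cs by (auto simp: E_def)
      have s: "\<tau> \<le> s" by (rule D[OF csD(1)])
      have nC: "\<not> C z (10 * s)"
      proof
        assume "C z (10 * s)"
        then obtain c' s' where "(c', s') \<in> E" "10 * s \<le> 5 * s'"
          using cover[of "10 * s" z] s \<tau> by (auto simp: E_def)
        then show False using max[of c' s'] s \<tau> by linarith
      qed
      show ?thesis
      proof (cases "10 * s \<le> h")
        case True
        then show ?thesis
          using nC s \<tau> Wmono[of \<rho> "\<rho> + 10 * s"] by (intro exI[of _ "10 * s"]) auto
      next
        case False
        have "dist x c < r' + 5 * s"
          using dist_triangle[of x c z] z \<open>\<rho> \<le> r'\<close> csD(2) by (simp add: dist_commute)
        then have in1: "(c, s) \<in> F \<rho>"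
          using False csD z by (auto simp: F_def intro!: bexI[of _ z])
        have "dist x w < \<rho> + 10 * s" if "dist c w < 5 * s" for w
          using dist_triangle[of x w z] dist_triangle[of z w c] z csD(2) that
          by (simp add: dist_commute)
        then have notin: "(c, s) \<notin> F (\<rho> + 10 * s)"
          by (force simp: F_def)
        have "10 * s + W (\<rho> + 10 * s) = (\<Sum>(c, s)\<in>insert (c, s) (F (\<rho> + 10 * s)). 10 * s)"
          using notin finF by (simp add: W_def)
        also have "\<dots> \<le> W \<rho>"
          unfolding W_def
        proof (rule sum_mono2[OF finF])
          have "F (\<rho> + 10 * s) \<subseteq> F \<rho>" using s \<tau> by (intro Fmono) simp
          then show "insert (c, s) (F (\<rho> + 10 * s)) \<subseteq> F \<rho>" using in1 by blast
        qed (use Fnn FD in blast)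
        finally show ?thesis
          using nC s \<tau> by (intro exI[of _ "10 * s"]) auto
      qed
    qed
    then obtain l where l: "\<tau> \<le> l" "\<not> C z l" "l + W (\<rho> + l) \<le> h + W \<rho>" by blast
    have room': "\<rho> + l + real m * h + W (\<rho> + l) \<le> r'"
      using l(3) Suc.prems(3) mh by linarith
    then have gain: "exp 1 * S \<rho> \<le> S (\<rho> + l)"
      using l Wnn[of "\<rho> + l"] mhn by (intro zs) auto
    moreover have "0 < exp 1 * S \<rho>" using Suc.prems(2) by simp
    ultimately have "exp (real m) * S (\<rho> + l) \<le> S r'"
      using Suc.prems(1) l \<tau> room' by (intro Suc.IH) auto
    moreover have "exp (real (Suc m)) * S \<rho> = exp (real m) * (exp 1 * S \<rho>)"
      by (simp add: exp_add mult_ac)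
    moreover have "exp (real m) * (exp 1 * S \<rho>) \<le> exp (real m) * S (\<rho> + l)"
      using gain by (intro mult_left_mono) auto
    ultimately show ?case by linarith
  qed
  have "W r \<le> (\<Sum>(c, s)\<in>{(c, s)\<in>D. h < 10 * s \<and> dist x c < r' + 5 * s}. 10 * s)"
    unfolding W_def
    by (rule sum_mono2) (use Fnn in \<open>auto simp: F_def intro: finite_subset[OF _ fin]\<close>)
  then show ?thesis using room pos by (intro main) auto
qed

section \<open>Charging the scales to crowded balls\<close>

lemma dyadic_sum_le:
  fixes a T :: real
  assumes a: "0 < a" and m: "1 \<le> m" and T: "0 \<le> T"
  shows "(\<Sum>j<J. if 2 ^ j * a < T then (2 ^ j * a) ^ m else 0) \<le> 2 * T ^ m"
proof -
  have all: "(\<Sum>j\<le>k. (2 ^ j * a) ^ m) \<le> 2 * (2 ^ k * a) ^ m" for k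
  proof (induction k)
    case 0
    show ?case using a by simp
  next
    case (Suc k)
    have "(2::real) * 1 \<le> 2 ^ m" using power_increasing[OF m, of "2::real"] by simp
    then have "2 * (2 ^ k * a) ^ m \<le> 2 ^ m * (2 ^ k * a) ^ m"
      using a by (intro mult_right_mono) auto
    also have "\<dots> = (2 ^ Suc k * a) ^ m" by (simp add: power_mult_distrib[symmetric] mult_ac)
    finally show ?case using Suc by simp
  qed
  show ?thesis
  proof (induction J)
    case 0
    show ?case using T by simp
  next
    case (Suc J)
    show ?case
    proof (cases "2 ^ J * a < T")
      case True
      have "(\<Sum>j<Suc J. if 2 ^ j * a < T then (2 ^ j * a) ^ m else 0) \<le> (\<Sum>j<Suc J. (2 ^ j * a) ^ m)"
        using a by (intro sum_mono) auto
      also have "\<dots> \<le> 2 * (2 ^ J * a) ^ m" using all[of J] by (simp add: lessThan_Suc_atMost)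
      also have "\<dots> \<le> 2 * T ^ m" using True a by (intro mult_left_mono power_mono) auto
      finally show ?thesis .
    next
      case False
      then show ?thesis using Suc by simp
    qed
  qed
qed

text \<open>Integrating the hypothesis \<open>charge\<close> over \<open>X\<close> and exchanging the sums leaves, for each \<open>(c, s)\<close>,
  the sum over the scales \<open>r < n * s\<close> of \<open>s / r\<close> times the volume of \<open>ball c (3 * r)\<close>. This is a geometric
  sum with exponent \<open>d - 1 \<ge> 1\<close> in dimension \<open>d\<close>, hence comparable to its largest term, and the number \<open>J\<close> of
  scales does not enter the result.\<close>

lemma scale_charging:
  fixes D :: "('a::euclidean_space \<times> real) set"
  assumes fin: "finite D" and D: "\<And>c s. (c, s) \<in> D \<Longrightarrow> 0 \<le> s" and a: "0 < a"
    and dim: "2 \<le> DIM('a)" and X: "X \<in> fmeasurable lborel" and n: "0 \<le> n"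
    and charge: "\<And>x. x \<in> X \<Longrightarrow>
      k \<le> (\<Sum>j<J. \<Sum>(c, s)\<in>{(c, s)\<in>D. 2 ^ j * a < n * s \<and> dist x c < 3 * (2 ^ j * a)}. s / (2 ^ j * a))"
  shows "k * measure lborel X \<le>
           2 * 3 ^ DIM('a) * n ^ (DIM('a) - 1) * unit_ball_vol DIM('a) * (\<Sum>(c, s)\<in>D. s ^ DIM('a))"
proof -
  let ?d = "DIM('a)" and ?v = "unit_ball_vol DIM('a)"
  let ?r = "\<lambda>j::nat. 2 ^ j * a"
  define w where "w j (b :: 'a \<times> real) = (if ?r j < n * snd b then snd b / ?r j else 0)" for j b
  have r: "0 < ?r j" for j using a by simp
  have wnn: "0 \<le> w j b" if "b \<in> D" for j b
    using D[of "fst b" "snd b"] that r[of j] by (auto simp: w_def)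
  have "k * measure lborel X = (LINT x|lborel. k * indicator X x)"
    using X by (simp add: fmeasurable_def)
  also have "\<dots> \<le> (LINT x|lborel. (\<Sum>j<J. \<Sum>b\<in>D. w j b * indicator (ball (fst b) (3 * ?r j)) x))"
  proof (rule integral_mono)
    show "integrable lborel (\<lambda>x. k * indicat_real X x)"
      using X by (intro integrable_mult_right integrable_real_indicator) (auto simp: fmeasurable_def)
    show "integrable lborel (\<lambda>x. \<Sum>j<J. \<Sum>b\<in>D. w j b * indicat_real (ball (fst b) (3 * ?r j)) x)"
      by (intro Bochner_Integration.integrable_sum integrable_mult_right integrable_ball_indicator)
    fix x :: 'a
    show "k * indicat_real X x \<le> (\<Sum>j<J. \<Sum>b\<in>D. w j b * indicat_real (ball (fst b) (3 * ?r j)) x)"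
    proof (cases "x \<in> X")
      case True
      have "(\<Sum>(c, s)\<in>{(c, s)\<in>D. ?r j < n * s \<and> dist x c < 3 * ?r j}. s / ?r j)
          = (\<Sum>b\<in>D. w j b * indicat_real (ball (fst b) (3 * ?r j)) x)" for j
      proof -
        have "(\<Sum>b\<in>D. w j b * indicat_real (ball (fst b) (3 * ?r j)) x)
            = (\<Sum>b\<in>D. if ?r j < n * snd b \<and> dist x (fst b) < 3 * ?r j then snd b / ?r j else 0)"
          by (intro sum.cong) (auto simp: w_def indicator_def dist_commute)
        also have "\<dots> = (\<Sum>b\<in>{b\<in>D. ?r j < n * snd b \<and> dist x (fst b) < 3 * ?r j}. snd b / ?r j)"
          by (rule sum.inter_filter[OF fin, symmetric])
        also have "{b\<in>D. ?r j < n * snd b \<and> dist x (fst b) < 3 * ?r j}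
            = {(c, s)\<in>D. ?r j < n * s \<and> dist x c < 3 * ?r j}" by auto
        finally show ?thesis by (simp add: case_prod_beta)
      qed
      then show ?thesis using charge[OF True] True by simp
    next
      case False
      then show ?thesis by (auto intro!: sum_nonneg mult_nonneg_nonneg wnn)
    qed
  qed
  also have "\<dots> = (\<Sum>j<J. \<Sum>b\<in>D. w j b * measure lborel (ball (fst b) (3 * ?r j)))"
    by (simp add: Bochner_Integration.integral_sum Bochner_Integration.integrable_sum
        integrable_mult_right integrable_ball_indicator)
  also have "\<dots> = (\<Sum>b\<in>D. \<Sum>j<J. w j b * measure lborel (ball (fst b) (3 * ?r j)))"
    by (rule sum.swap)
  also have "\<dots> \<le> (\<Sum>b\<in>D. 2 * 3 ^ ?d * n ^ (?d - 1) * ?v * snd b ^ ?d)"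
  proof (rule sum_mono)
    fix b assume b: "b \<in> D"
    then have s: "0 \<le> snd b" using D[of "fst b" "snd b"] by simp
    have pw: "x * x ^ (?d - 1) = x ^ ?d" for x :: real
      using dim by (cases "?d") auto
    have term_eq: "w j b * measure lborel (ball (fst b) (3 * ?r j))
        = 3 ^ ?d * ?v * snd b * (if ?r j < n * snd b then ?r j ^ (?d - 1) else 0)" for j
    proof -
      have "?r j ^ ?d / ?r j = ?r j ^ (?d - 1)"
        unfolding pw[symmetric] by (rule nonzero_mult_div_cancel_left) (use a in simp)
      moreover have eqx: "snd b / x * (?v * (3 * x) ^ ?d) = 3 ^ ?d * ?v * snd b * (x ^ ?d / x)" for x :: real
        by (simp add: power_mult_distrib)
      ultimately have "snd b / ?r j * (?v * (3 * ?r j) ^ ?d) = 3 ^ ?d * ?v * snd b * ?r j ^ (?d - 1)"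
        by (simp only: eqx)
      moreover have "measure lborel (ball (fst b) (3 * ?r j)) = ?v * (3 * ?r j) ^ ?d"
        using r[of j] by (intro content_ball) simp
      ultimately show ?thesis
        by (cases "?r j < n * snd b") (simp_all only: w_def if_True if_False mult_zero_left mult_zero_right)
    qed
    have "(\<Sum>j<J. w j b * measure lborel (ball (fst b) (3 * ?r j)))
        = 3 ^ ?d * ?v * snd b * (\<Sum>j<J. if ?r j < n * snd b then ?r j ^ (?d - 1) else 0)"
      by (simp only: term_eq sum_distrib_left)
    also have "\<dots> \<le> 3 ^ ?d * ?v * snd b * (2 * (n * snd b) ^ (?d - 1))"
      using s n dim by (intro mult_left_mono dyadic_sum_le a) auto
    also have "\<dots> = 2 * 3 ^ ?d * n ^ (?d - 1) * ?v * (snd b * snd b ^ (?d - 1))"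
      by (simp add: power_mult_distrib mult_ac)
    finally show "(\<Sum>j<J. w j b * measure lborel (ball (fst b) (3 * ?r j)))
        \<le> 2 * 3 ^ ?d * n ^ (?d - 1) * ?v * snd b ^ ?d" by (simp only: pw)
  qed
  also have "\<dots> = 2 * 3 ^ ?d * n ^ (?d - 1) * ?v * (\<Sum>(c, s)\<in>D. s ^ ?d)"
    by (simp add: sum_distrib_left case_prod_beta)
  finally show ?thesis .
qed

text \<open>Monotonicity lets the scales without the gain \<open>exp n\<close> be skipped.\<close>

lemma count_fast_steps:
  fixes S :: "nat \<Rightarrow> real"
  assumes "\<And>j. j < J \<Longrightarrow> S j \<le> S (Suc j)" "0 \<le> S 0"
  shows "exp (real n * card {j. j < J \<and> exp (real n) * S j \<le> S (Suc j)}) * S 0 \<le> S J"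
  using assms(1)
proof (induction J)
  case 0
  show ?case by simp
next
  case (Suc J)
  let ?F = "\<lambda>J. {j. j < J \<and> exp (real n) * S j \<le> S (Suc j)}"
  have IH: "exp (real n * card (?F J)) * S 0 \<le> S J" using Suc by simp
  show ?case
  proof (cases "exp (real n) * S J \<le> S (Suc J)")
    case True
    then have "?F (Suc J) = insert J (?F J)" by (auto simp: less_Suc_eq)
    then have "exp (real n * card (?F (Suc J))) * S 0 = exp (real n) * (exp (real n * card (?F J)) * S 0)"
      by (simp add: exp_add distrib_left mult_ac)
    also have "\<dots> \<le> exp (real n) * S J" using IH by (intro mult_left_mono) auto
    finally show ?thesis using True by linarith
  next
    case False
    then have "?F (Suc J) = ?F J" by (auto simp: less_Suc_eq)
    then show ?thesis using IH Suc.prems[of J] by simp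
  qed
qed

section \<open>Growth in a cube with few rogue cubes\<close>

text \<open>Suppose that the supremum is smaller than claimed. Around every typical point \<open>x\<close>
  at least half of the scales \<open>r j\<close> with \<open>j < J\<close> are slow, and \<open>radial_growth\<close> then
  forces every slow scale to be charged to selected balls. Typical means two things. Outside the rogue
  cubes, (P1) makes the supremum at the smallest scale at least 1. Outside the balls
  \<open>ball c (20 * s)\<close>, a selected ball can only matter at a scale \<open>r\<close> if \<open>s\<close> is smaller than \<open>r\<close>, so that its
  charge reaches only points at distance \<open>3 * r\<close>. The hypothesis \<open>few\<close> makes at least half of
  \<open>ball 0 (N / 2)\<close> typical, \<open>steps\<close> contradicts \<open>scale_charging\<close>, and \<open>room\<close> keeps all scales
  inside \<open>ball 0 N\<close>.\<close>

lemma sup_growth: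
  fixes u :: "real^'n \<Rightarrow> real" and \<mu> :: "(real^'n) measure" and n J :: nat and N \<Delta> :: real
  defines "Q \<equiv> cbox (vec (- N)) (vec N) :: (real^'n) set" and "d \<equiv> CARD('n)"
  defines "P \<equiv> real (card (rogue_cubes \<Delta> \<mu> u Q))" and "V \<equiv> unit_ball_vol (CARD('n)) * (N / 2) ^ CARD('n)"
  assumes dim: "2 \<le> CARD('n)"
    and \<mu>: "\<mu> \<in> M_class \<psi>" and u: "u \<in> F_class r\<^sub>0 A B \<mu>" and AB: "1 \<le> A" "1 \<le> B"
    and mono: "mono_on {0..1} \<psi>" and \<psi>: "\<psi> (2 * \<eta>) \<le> \<Delta>" and \<eta>: "0 < \<eta>" "2 * \<eta> \<le> 1"
    and \<Delta>: "0 < \<Delta>" "12 * A * B * \<Delta> \<le> 1"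
    and \<tau>: "0 < \<tau>" "r\<^sub>0 < \<tau>" "(CARD('n))\<^sup>2 / \<eta> \<le> \<tau>"
    and n: "1 \<le> n"
    and few: "2 * (1 + 20 ^ d / \<eta>) * P \<le> V"
    and steps: "160 * 3 ^ d * (20 * real n) ^ (d - 1) * P < \<eta> * real J * V"
    and room: "2 ^ J * (4 * real n * \<tau>) \<le> N"
  shows "exp (real n * real J / 2) \<le> (SUP y\<in>ball 0 N. u y)"
proof (rule ccontr)
  assume small: "\<not> ?thesis"
  define U where "U = \<Union> (rogue_cubes \<Delta> \<mu> u Q)"
  (* The smallest scale is chosen such that steps of length r j / (2 * n) are never below \<tau>. *)
  define r where "r j = 2 ^ j * (2 * real n * \<tau>)" for j :: nat
  define v where "v = unit_ball_vol (real d)"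
  have v: "0 < v" by (simp add: v_def)
  have usc: "upper_semicontinuous u" using u by (simp add: F_class_def)
  have Q: "bounded Q" by (simp add: Q_def)
  have U: "U \<in> sets borel" "emeasure lborel U \<le> ennreal P"
    unfolding U_def P_def by (rule rogue_region_borel[OF Q], rule rogue_region_measure_le[OF Q])
  have P: "0 \<le> P" by (simp add: P_def)
  have BQ: "ball 0 N \<subseteq> Q"
  proof
    fix x :: "real^'n" assume "x \<in> ball 0 N"
    then have "\<bar>x $ i\<bar> \<le> N" for i
      using component_le_norm_cart[of x i] by simp
    then show "x \<in> Q" by (simp add: Q_def mem_box_cart abs_le_iff) (metis minus_le_iff)
  qed
  have d\<tau>: "real d \<le> \<tau>"
  proof -
    have "real d * 1 \<le> real d * (real d / \<eta>)"
      using \<eta> dim by (intro mult_left_mono) (auto simp: d_def field_simps)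
    then show ?thesis using \<tau>(3) by (simp add: d_def power2_eq_square)
  qed
  have r0: "\<tau> \<le> r 0" "0 < r j" for j
    using n \<tau> by (auto simp: r_def)
  have rJ: "r j \<le> N / 2" if "j \<le> J" for j
  proof -
    have "r j \<le> 2 ^ J * (2 * real n * \<tau>)"
      unfolding r_def using that \<tau> by (intro mult_right_mono power_increasing) auto
    then show ?thesis using room by simp
  qed
  have N: "0 < N" using rJ[of 0] r0 by (smt (verit) field_sum_of_halves le0)
  obtain D where D: "finite D" "\<And>c s. (c, s) \<in> D \<Longrightarrow> \<tau> \<le> s"
    "\<And>z t. \<tau> \<le> t \<Longrightarrow> crowded \<eta> U z t \<Longrightarrow> \<exists>(c, s)\<in>D. z \<in> ball c (5 * s) \<and> t \<le> 5 * s"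
    "\<eta> * v * (\<Sum>(c, s)\<in>D. s ^ d) \<le> P"
    using crowded_ball_selection[OF U P \<eta>(1) \<tau>(1)] by (auto simp: v_def d_def)
  define X where "X = ball 0 (N / 2) - (U \<union> (\<Union>(c, s)\<in>D. ball c (20 * s)))"
  have Db: "(\<Union>(c, s)\<in>D. ball c (20 * s)) \<in> sets borel"
    using D(1) by (intro sets.finite_UN) auto
  have X: "X \<in> fmeasurable lborel"
    unfolding X_def using U(1) Db by (intro fmeasurable_Diff) (auto simp: ball_fmeasurable)
  have mX: "V / 2 \<le> measure lborel X"
  proof -
    have mU: "measure lborel U \<le> P"
      using U(2) P by (simp add: measure_def enn2real_leI)
    have "(\<Sum>(c, s)\<in>D. measure lborel (ball c (20 * s))) = (\<Sum>(c, s)\<in>D. v * 20 ^ d * s ^ d)"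
    proof (intro sum.cong refl, clarify)
      fix c s assume "(c, s) \<in> D"
      then show "measure lborel (ball c (20 * s)) = v * 20 ^ d * s ^ d"
        using D(2)[of c s] \<tau> by (simp add: content_ball_cart v_def d_def power_mult_distrib)
    qed
    also have "\<dots> = v * 20 ^ d * (\<Sum>(c, s)\<in>D. s ^ d)"
      by (simp add: sum_distrib_left[symmetric] case_prod_beta)
    also have "\<dots> \<le> 20 ^ d * P / \<eta>"
    proof -
      have "v * (\<Sum>(c, s)\<in>D. s ^ d) \<le> P / \<eta>"
        using D(4) \<eta> by (simp add: field_simps)
      then have "20 ^ d * (v * (\<Sum>(c, s)\<in>D. s ^ d)) \<le> 20 ^ d * (P / \<eta>)"
        by (intro mult_left_mono) auto
      then show ?thesis by (simp add: mult_ac)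
    qed
    finally have sumD: "(\<Sum>(c, s)\<in>D. measure lborel (ball c (20 * s))) \<le> 20 ^ d * P / \<eta>" .
    have Ufin: "U \<in> fmeasurable lborel"
      using U by (auto simp: fmeasurable_def intro: le_less_trans)
    have Dfin: "(\<Union>b\<in>D. ball (fst b) (20 * snd b)) \<in> fmeasurable lborel"
      using D(1) by (intro fmeasurable.finite_UN) (auto simp: ball_fmeasurable)
    have "measure lborel (ball 0 (N/2) :: (real^'n) set) \<le> measure lborel (X \<union> (U \<union> (\<Union>b\<in>D. ball (fst b) (20 * snd b))))"
      using X Ufin Dfin
      by (intro measure_mono_fmeasurable fmeasurable.Un) (auto simp: X_def case_prod_beta)
    also have "\<dots> \<le> measure lborel X + (measure lborel U + measure lborel (\<Union>b\<in>D. ball (fst b) (20 * snd b)))"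
      by (intro order_trans[OF measure_Un_le] add_left_mono measure_Un_le fmeasurableD fmeasurable.Un
          X Ufin Dfin)
    also have "measure lborel (\<Union>b\<in>D. ball (fst b) (20 * snd b)) \<le> (\<Sum>b\<in>D. measure lborel (ball (fst b) (20 * snd b)))"
      using D(1) by (intro measure_UNION_le) auto
    finally have "V \<le> measure lborel X + (P + 20 ^ d * P / \<eta>)"
      using mU sumD N by (simp add: content_ball_cart V_def case_prod_beta)
    moreover define k where "k = 20 ^ d * P / \<eta>"
    moreover have "2 * (1 + 20 ^ d / \<eta>) * P = 2 * (P + k)"
      by (simp add: k_def algebra_simps)
    ultimately show ?thesis using few by simp
  qed
  have charge: "real J / 40 \<le> (\<Sum>j<J. \<Sum>(c, s)\<in>{(c, s)\<in>D. 2 ^ j * (2 * real n * \<tau>) < 20 * real n * s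
      \<and> dist x c < 3 * (2 ^ j * (2 * real n * \<tau>))}. s / (2 ^ j * (2 * real n * \<tau>)))"
    if x: "x \<in> X" for x
  proof -
    define S where "S \<rho> = (SUP y\<in>cball x \<rho>. u y)" for \<rho>
    have S_mono: "S \<rho> \<le> S \<rho>'" if "0 \<le> \<rho>" "\<rho> \<le> \<rho>'" for \<rho> \<rho>'
      unfolding S_def using that
      by (intro cSUP_subset_mono upper_semicontinuous_bdd_above[OF usc]) auto
    have xN: "norm x < N / 2" using x by (simp add: X_def)
    have near: "y \<in> ball 0 N" if "dist x y \<le> N / 2" for y
      using that xN norm_triangle_ineq2[of y x] by (simp add: dist_norm norm_minus_commute)
    have "1 \<le> S (r 0)"
    proof -
      obtain I where I: "I \<in> basic_cubes" "x \<in> I" using ex_basic_cube by blast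
      have close: "dist x y \<le> r 0" if "y \<in> I" for y
        using basic_cube_dist_le[OF I that] d\<tau> r0(1) by (simp add: d_def)
      have "I \<subseteq> Q" using close rJ[of 0] near BQ by force
      moreover have "x \<notin> U" using x by (simp add: X_def)
      ultimately have "oscillates_in \<Delta> \<mu> u I"
        using I by (auto simp: U_def rogue_cubes_def)
      then have "1 \<le> (SUP y\<in>I. u y)" by (simp add: oscillates_in_def)
      also have "\<dots> \<le> S (r 0)"
        unfolding S_def using I close
        by (intro cSUP_subset_mono upper_semicontinuous_bdd_above[OF usc]) auto
      finally show ?thesis .
    qed
    have S_pos: "0 < S \<rho>" if "r 0 \<le> \<rho>" for \<rho>
      using \<open>1 \<le> S (r 0)\<close> S_mono[of "r 0" \<rho>] that r0(2)[of 0] by linarith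
    have r_ge: "r 0 \<le> r j" for j
      using \<tau> mult_right_mono[of 1 "2 ^ j" "2 * real n * \<tau>"] by (simp add: r_def)
    have r_Suc: "r (Suc j) = 2 * r j" for j by (simp add: r_def)
    let ?fast = "\<lambda>j. exp (real n) * S (r j) \<le> S (r (Suc j))"
    let ?W = "\<lambda>j. \<Sum>(c, s)\<in>{(c, s)\<in>D. r j < 20 * real n * s \<and> dist x c < 3 * r j}. s / r j"
    have W_nn: "0 \<le> ?W j" for j
      using D(2) \<tau> r0(2)[of j] by (intro sum_nonneg) (force intro!: divide_nonneg_pos)
    (* n steps of length h cover only n * h = r j / 2, so the other half of the way from r j to
       2 * r j must be filled by steps of length 10 * s. *)
    have slow: "1 / 20 \<le> ?W j" if j: "j < J" "\<not> ?fast j" for j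
    proof -
      define h where "h = r j / (2 * real n)"
      have h: "\<tau> \<le> h"
      proof -
        have "h = 2 ^ j * \<tau>" using n by (simp add: h_def r_def)
        then show ?thesis using \<tau> by (simp add: mult_le_cancel_right1)
      qed
      let ?E = "{(c, s)\<in>D. h < 10 * s \<and> dist x c < r (Suc j) + 5 * s}"
      have "\<not> r j + real n * h + (\<Sum>(c, s)\<in>?E. 10 * s) \<le> r (Suc j)"
      proof
        assume room_j: "r j + real n * h + (\<Sum>(c, s)\<in>?E. 10 * s) \<le> r (Suc j)"
        have "?fast j"
        proof (rule radial_growth[where \<tau> = \<tau> and h = h and D = D and C = "crowded \<eta> U" and x = x
              and r = "r j" and r' = "r (Suc j)" and S = S and n = n])
          fix \<rho> assume \<rho>: "r j \<le> \<rho>" "\<rho> \<le> r (Suc j)" "0 < S \<rho>"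
          have sub: "cball x (r (Suc j)) \<subseteq> Q"
            using j rJ[of "Suc j"] near BQ by force
          have "0 \<le> \<rho>" using \<rho> r0(2)[of j] by linarith
          then obtain z where z: "dist x z = \<rho>" "\<And>l. \<tau> \<le> l \<Longrightarrow> cball x (\<rho> + l) \<subseteq> Q \<Longrightarrow> \<not> crowded \<eta> U z l \<Longrightarrow>
              exp 1 * S \<rho> \<le> S (\<rho> + l)"
            using growth_step[OF \<mu> u AB mono \<psi> \<eta> \<Delta> \<tau> Q, of \<rho> x] \<rho> by (auto simp: S_def U_def)
          then show "\<exists>z. dist x z = \<rho> \<and> (\<forall>l\<ge>\<tau>. \<rho> + l \<le> r (Suc j) \<longrightarrow> \<not> crowded \<eta> U z l \<longrightarrow>
              exp 1 * S \<rho> \<le> S (\<rho> + l))"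
            using sub subset_cball order_trans by blast
        next
          fix \<rho> assume "r j \<le> \<rho>" "\<rho> \<le> r (Suc j)"
          then show "S \<rho> \<le> S (r (Suc j))" using r0(2)[of j] by (intro S_mono) auto
        qed (use D \<tau> h room_j S_pos r_ge in auto)
        with j show False by blast
      qed
      moreover have "real n * h = r j / 2" using n by (simp add: h_def)
      ultimately have big: "r j / 2 < (\<Sum>(c, s)\<in>?E. 10 * s)" by (simp add: r_Suc)
      also have "\<dots> \<le> (\<Sum>(c, s)\<in>{(c, s)\<in>D. r j < 20 * real n * s \<and> dist x c < 3 * r j}. 10 * s)"
      proof (rule sum_mono2)
        show "finite {(c, s)\<in>D. r j < 20 * real n * s \<and> dist x c < 3 * r j}"
          by (rule finite_subset[OF _ D(1)]) auto
        show "?E \<subseteq> {(c, s)\<in>D. r j < 20 * real n * s \<and> dist x c < 3 * r j}"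
        proof clarify
          fix c s assume cs: "(c, s) \<in> D" "h < 10 * s" "dist x c < r (Suc j) + 5 * s"
          have "x \<notin> ball c (20 * s)" using x cs(1) by (auto simp: X_def)
          then have "20 * s \<le> dist x c" by (simp add: dist_commute)
          then have "dist x c < 3 * r j" using cs(3) r_Suc[of j] r0(2)[of j] by linarith
          moreover have "r j < 20 * real n * s"
            using cs(2) n by (simp add: h_def field_simps)
          ultimately show "r j < 20 * real n * s \<and> dist x c < 3 * r j" by simp
        qed
        show "0 \<le> (case b of (c, s) \<Rightarrow> 10 * s)" 
          if "b \<in> {(c, s)\<in>D. r j < 20 * real n * s \<and> dist x c < 3 * r j} - ?E" for b
          using that D(2) \<tau> by (cases b) force
      qed
      also have "\<dots> = 10 * r j * ?W j"
        using r0(2)[of j] by (simp add: sum_distrib_left case_prod_beta)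
      finally show ?thesis using r0(2)[of j] by (simp add: field_simps)
    qed
    define F where "F = {j. j < J \<and> ?fast j}"
    have F: "finite F" "F \<subseteq> {..<J}" by (auto simp: F_def)
    have "exp (real n * card F) * S (r 0) \<le> S (r J)"
      unfolding F_def using S_pos[of "r 0"] r0(2)
      by (intro count_fast_steps[of J "\<lambda>j. S (r j)" n]) (auto intro!: S_mono simp: r_Suc less_imp_le)
    moreover have "exp (real n * card F) * 1 \<le> exp (real n * card F) * S (r 0)"
      using \<open>1 \<le> S (r 0)\<close> by (intro mult_left_mono) auto
    moreover have "S (r J) \<le> (SUP y\<in>ball 0 N. u y)"
      unfolding S_def using near rJ[of J] r0(2)[of J]
      by (intro cSUP_subset_mono upper_semicontinuous_bdd_above[OF usc]) force+
    ultimately have "exp (real n * card F) < exp (real n * real J / 2)"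
      using small by linarith
    then have "real n * card F < real n * (real J / 2)" by simp
    then have "real (card F) < real J / 2" using n by (simp add: mult_less_cancel_left)
    moreover have "card ({..<J} - F) = J - card F" "card F \<le> J"
      using F card_mono[OF _ F(2)] by (auto simp: card_Diff_subset)
    ultimately have "real J / 40 \<le> (\<Sum>j\<in>{..<J} - F. 1 / 20)" by (simp add: of_nat_diff)
    also have "\<dots> \<le> (\<Sum>j\<in>{..<J} - F. ?W j)"
      by (intro sum_mono slow) (auto simp: F_def)
    also have "\<dots> \<le> (\<Sum>j<J. ?W j)"
      by (intro sum_mono2 W_nn) auto
    finally show ?thesis by (simp only: r_def)
  qed
  have "real J / 40 * measure lborel X \<le> 2 * 3 ^ DIM(real^'n) * (20 * real n) ^ (DIM(real^'n) - 1)
      * unit_ball_vol DIM(real^'n) * (\<Sum>(c, s)\<in>D. s ^ DIM(real^'n))"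
  proof (rule scale_charging[where a = "2 * real n * \<tau>" and J = J])
    show "0 \<le> s" if "(c, s) \<in> D" for c s using D(2)[OF that] \<tau> by simp
  qed (use D(1) X \<tau> n dim charge in auto)
  then have "real J / 40 * measure lborel X \<le>
      2 * 3 ^ d * (20 * real n) ^ (d - 1) * v * (\<Sum>(c, s)\<in>D. s ^ d)"
    by (simp add: d_def v_def)
  moreover have "real J / 40 * (V / 2) \<le> real J / 40 * measure lborel X"
    using mX by (intro mult_left_mono) auto
  moreover have "2 * 3 ^ d * (20 * real n) ^ (d - 1) * (\<eta> * v * (\<Sum>(c, s)\<in>D. s ^ d))
      \<le> 2 * 3 ^ d * (20 * real n) ^ (d - 1) * P"
    using D(4) by (intro mult_left_mono) auto
  ultimately have "\<eta> * (real J / 40 * (V / 2)) \<le> 2 * 3 ^ d * (20 * real n) ^ (d - 1) * P"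
    using \<eta>(1) by (smt (verit, best) mult.assoc mult.left_commute mult_le_cancel_left_pos)
  then show False using steps by (simp add: field_simps)
qed

section \<open>The growth rate\<close>

text \<open>The conditions on \<open>n\<close> and \<open>J\<close> that \<open>sup_growth\<close> imposes can be met with \<open>n * J\<close> of the order of the
  growth rate. Replacing \<open>q\<close> by its maximum with a constant \<open>Q\<^sub>0\<close> makes \<open>J \<ge> 1\<close> and treats the
  regime of bounded \<open>q\<close> together with the rest; it costs only a constant. The number \<open>n\<close> is the largest
  that the third condition allows. With it the fourth reads, up to constants,
  \<open>2 ^ (m * J) * J \<le> q\<close>, and as \<open>J \<le> 2 ^ J\<close>, it suffices that \<open>4 ^ (m + 1)\<close> to the
  power \<open>J\<close> is at most \<open>q\<close>: half of the exponent is kept to absorb the constants.\<close>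

lemma exists_steps_and_scales:
  fixes \<kappa> \<tau> q Q\<^sub>0 R N :: real and m :: nat
  assumes m: "1 \<le> m" and \<kappa>: "0 < \<kappa>" and \<tau>: "0 < \<tau>"
    and Q\<^sub>0: "4 ^ (m + 1) \<le> Q\<^sub>0" "(\<kappa> * (4 * \<tau>) ^ m)\<^sup>2 \<le> Q\<^sub>0"
    and q: "0 < q" and N: "0 < N" "0 \<le> R" "R \<le> 3 * N"
    and room: "max q Q\<^sub>0 \<le> \<kappa> * N ^ m"
  obtains n J :: nat where "1 \<le> n" "1 \<le> J" "real n ^ m * max q Q\<^sub>0 \<le> \<kappa> * real J * N ^ m"
    "2 ^ J * (4 * real n * \<tau>) \<le> N"
    "\<kappa> powr (1 / m) * (1 / (4 * ln (4 ^ (m + 1)))) powr ((m + 1) / m) / (12 * Q\<^sub>0 powr (1 / m)) *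
       (R / (1 + q powr (1 / m)) * ln (2 + q) powr ((m + 1) / m)) \<le> real n * real J / 2"
proof -
  let ?q = "max q Q\<^sub>0"
  define b :: real where "b = 4 ^ (m + 1)"
  define J where "J = nat \<lfloor>log b ?q\<rfloor>"
  have b: "4 \<le> b" unfolding b_def using power_increasing[of 1 "m + 1" "4::real"] by simp
  have q4: "4 \<le> ?q" "b \<le> ?q" "1 \<le> Q\<^sub>0" using Q\<^sub>0(1) b unfolding b_def by linarith+
  have "log b b \<le> log b ?q" using q4 b by (intro log_mono) auto
  moreover have "log b b = 1" by (rule log_eq_one) (use b in linarith)+
  ultimately have "1 \<le> log b ?q" by linarith
  then have J: "1 \<le> J" "real J \<le> log b ?q" "log b ?q < real J + 1"
    unfolding J_def by linarith+
  have bJ: "b ^ J \<le> ?q"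
  proof -
    have "b ^ J = b powr real J" using b by (subst powr_realpow) auto
    also have "\<dots> \<le> b powr log b ?q" using J b by (intro powr_mono) auto
    also have "\<dots> = ?q" using b q4 by (intro powr_log_cancel) auto
    finally show ?thesis .
  qed
  have lnJ: "ln (2 + q) / (4 * ln b) \<le> real J"
  proof -
    have "2 + q \<le> ?q * ?q"
    proof -
      have "2 + q \<le> 2 * ?q" using q4 by linarith
      also have "\<dots> \<le> ?q * ?q" using q4 by (intro mult_right_mono) auto
      finally show ?thesis .
    qed
    then have "ln (2 + q) \<le> ln (?q * ?q)" using q by (intro ln_mono) auto
    also have "\<dots> = 2 * ln ?q" using q4 by (subst ln_mult) auto
    also have "ln ?q = log b ?q * ln b" using b by (simp add: log_def)
    also have "2 * (log b ?q * ln b) \<le> 2 * (2 * real J * ln b)"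
      using J b by (intro mult_left_mono mult_right_mono) auto
    finally show ?thesis using b by (simp add: divide_le_eq mult_ac)
  qed
  define y where "y = \<kappa> * real J * N ^ m / ?q"
  define g where "g = y powr (1 / m)"
  have y: "1 \<le> y"
  proof -
    have "\<kappa> * N ^ m * 1 \<le> \<kappa> * N ^ m * real J" using J \<kappa> N by (intro mult_left_mono) auto
    then have "?q \<le> \<kappa> * real J * N ^ m" using room by (simp add: mult_ac)
    then show ?thesis using q4 by (simp add: y_def)
  qed
  have g: "1 \<le> g" unfolding g_def using y m by (intro ge_one_powr_ge_zero) auto
  have gm: "g ^ m = y"
    unfolding g_def using y m by (simp add: powr_powr flip: powr_realpow')
  define n where "n = nat \<lfloor>g\<rfloor>"
  have n: "1 \<le> n" "real n \<le> g" "g / 2 \<le> real n"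
  proof -
    show "1 \<le> n" "real n \<le> g" using g unfolding n_def by linarith+
    moreover have "g < real n + 1" using g unfolding n_def by linarith
    ultimately show "g / 2 \<le> real n" by linarith
  qed
  have "real n ^ m \<le> y" using n(2) gm power_mono[of "real n" g m] by simp
  then have nm: "real n ^ m * ?q \<le> \<kappa> * real J * N ^ m"
    using q4 by (simp add: y_def field_simps)
  have fit: "2 ^ J * (4 * real n * \<tau>) \<le> N"
  proof (rule power_le_imp_le_base)
    let ?e = "\<kappa> * (4 * \<tau>) ^ m"
    have e: "0 \<le> ?e" using \<kappa> \<tau> by simp
    have "real J \<le> 2 ^ J" by (simp add: of_nat_less_two_power less_imp_le)
    then have "(2 ^ J) ^ m * real J \<le> (2 ^ J) ^ m * (2 ^ J :: real)" by (intro mult_left_mono) auto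
    also have "\<dots> = (2 ^ (m + 1)) ^ J" by (simp add: power_mult[symmetric] power_add[symmetric] algebra_simps)
    finally have 1: "(2 ^ J) ^ m * real J \<le> (2 ^ (m + 1) :: real) ^ J" .
    have "((2 ^ (m + 1) :: real) ^ J)\<^sup>2 = b ^ J"
    proof -
      have "(2 ^ (m + 1) :: real)\<^sup>2 = b"
        by (simp add: b_def power2_eq_square flip: power_mult_distrib)
      then show ?thesis by (metis power_mult mult.commute)
    qed
    then have 2: "(2 ^ (m + 1) :: real) ^ J \<le> sqrt ?q" using bJ by (intro real_le_rsqrt) simp
    have 3: "?e \<le> sqrt ?q" using Q\<^sub>0(2) by (intro real_le_rsqrt) simp
    have "(2 ^ J) ^ m * real J * ?e \<le> sqrt ?q * sqrt ?q"
      using order_trans[OF 1 2] 3 e q4 by (intro mult_mono) auto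
    then have 4: "(2 ^ J) ^ m * real J * ?e \<le> ?q" using q4 by simp
    have "(2 ^ J * (4 * real n * \<tau>)) ^ m * ?q = (2 ^ J) ^ m * (4 * \<tau>) ^ m * (real n ^ m * ?q)"
      by (simp add: power_mult_distrib mult_ac)
    also have "\<dots> \<le> (2 ^ J) ^ m * (4 * \<tau>) ^ m * (\<kappa> * real J * N ^ m)"
      using nm \<tau> by (intro mult_left_mono) auto
    also have "\<dots> = ((2 ^ J) ^ m * real J * ?e) * N ^ m" by (simp add: mult_ac)
    also have "\<dots> \<le> ?q * N ^ m" using 4 N by (intro mult_right_mono) auto
    finally have "(2 ^ J * (4 * real n * \<tau>)) ^ m * ?q \<le> N ^ m * ?q" by (simp only: mult.commute)
    then have "(2 ^ J * (4 * real n * \<tau>)) ^ m \<le> N ^ m"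
      by (rule mult_right_le_imp_le) (use q4 in linarith)
    then show "(2 ^ J * (4 * real n * \<tau>)) ^ Suc (m - 1) \<le> N ^ Suc (m - 1)" using m by simp
  qed (use N in simp)
  let ?p = "1 / real m" and ?s = "real (m + 1) / real m"
  have ps: "?s = 1 + ?p" using m by (simp add: field_simps)
  have growth: "\<kappa> powr ?p * (1 / (4 * ln b)) powr ?s / (12 * Q\<^sub>0 powr ?p) *
       (R / (1 + q powr ?p) * ln (2 + q) powr ?s) \<le> real n * real J / 2"
  proof -
    have Qp: "1 \<le> Q\<^sub>0 powr ?p" using q4(3) by (intro ge_one_powr_ge_zero) auto
    have qp: "?q powr ?p \<le> Q\<^sub>0 powr ?p * (1 + q powr ?p)"
    proof (cases "q \<le> Q\<^sub>0")
      case True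
      then show ?thesis by (simp add: max_def distrib_left)
    next
      case False
      have "1 * q powr ?p \<le> Q\<^sub>0 powr ?p * (q powr ?p)" using Qp by (intro mult_right_mono) auto
      then have "q powr ?p \<le> Q\<^sub>0 powr ?p * (1 + q powr ?p)"
        by (simp add: distrib_left add_increasing)
      then show ?thesis using False by (simp add: max_def)
    qed
    have l: "0 \<le> ln (2 + q)" "0 < ln b" using q b by auto
    have "(1 / (4 * ln b)) powr ?s * ln (2 + q) powr ?s = (ln (2 + q) / (4 * ln b)) powr ?s"
      using l by (subst powr_mult[symmetric]) auto
    also have "\<dots> \<le> real J powr ?s" using lnJ l by (intro powr_mono2) auto
    finally have Js: "(1 / (4 * ln b)) powr ?s * ln (2 + q) powr ?s \<le> real J powr ?s" .
    have "\<kappa> powr ?p * (1 / (4 * ln b)) powr ?s / (12 * Q\<^sub>0 powr ?p) *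
       (R / (1 + q powr ?p) * ln (2 + q) powr ?s)
      = \<kappa> powr ?p * ((1 / (4 * ln b)) powr ?s * ln (2 + q) powr ?s) * (R / 12 / (Q\<^sub>0 powr ?p * (1 + q powr ?p)))"
      by (simp add: mult_ac)
    also have "\<dots> \<le> \<kappa> powr ?p * real J powr ?s * (N / 4 / (Q\<^sub>0 powr ?p * (1 + q powr ?p)))"
      using Qp N Js by (intro mult_mono divide_right_mono mult_left_mono mult_nonneg_nonneg) auto
    also have "\<dots> \<le> \<kappa> powr ?p * real J powr ?s * (N / 4 / ?q powr ?p)"
      using qp q4 N by (intro mult_left_mono divide_left_mono) (auto intro!: mult_pos_pos add_pos_nonneg less_le_trans[OF _ Qp])
    also have "\<dots> = g * real J / 4"
    proof -
      have "(N ^ m) powr ?p = N"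
        using N m by (simp add: powr_powr flip: powr_realpow)
      then have g_eq: "g = \<kappa> powr ?p * real J powr ?p * N / ?q powr ?p"
        using \<kappa> N q4 by (simp add: g_def y_def powr_mult powr_divide)
      have J_eq: "real J powr ?s = real J powr ?p * real J"
        unfolding ps powr_add using J by simp
      show ?thesis unfolding g_eq J_eq by (simp add: mult_ac)
    qed
    also have "\<dots> \<le> real n * real J / 2"
    proof -
      have "g / 2 * real J \<le> real n * real J" using n by (intro mult_right_mono) auto
      then show ?thesis by simp
    qed
    finally show ?thesis .
  qed
  show thesis using that[OF n(1) J(1) nm fit growth[unfolded b_def]] .
qed

text \<open>A cube \<open>[-N, N] ^ d\<close> has edge length \<open>2 * N\<close>, and this is where \<open>f\<close> is evaluated.\<close>

lemma rogue_count_le: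
  fixes u :: "real^'n \<Rightarrow> real" and f :: "real \<Rightarrow> real"
  assumes osc: "f_oscillating \<Delta> \<mu> f u" and f: "\<And>t. 0 < t \<Longrightarrow> 0 < f t"
  shows "\<forall>\<^sub>F N::nat in sequentially.
           card (rogue_cubes \<Delta> \<mu> u (cbox (vec (- real N)) (vec (real N)))) \<le> f (2 * real N)"
proof -
  have "\<forall>\<^sub>F N::nat in sequentially. ereal (gamma \<Delta> \<mu> f u (vec (- real N)) (2 * real N)) < 1"
    using osc unfolding f_oscillating_def by (rule Limsup_lessD)
  then show ?thesis
    using eventually_gt_at_top[of 0]
  proof eventually_elim
    case (elim N)
    have "vec (- real N) + vec (2 * real N) = (vec (real N) :: real^'n)"
      by (simp add: vec_eq_iff)
    then show ?case
      using elim f[of "2 * real N"]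
      by (simp add: gamma_def rogue_cubes_def one_ereal_def divide_less_eq)
  qed
qed

theorem theorem1p3:
  fixes A B :: real and \<psi> :: "real \<Rightarrow> real"
  assumes "CARD('n::finite) \<ge> 2"
    and "A \<ge> 1" and "B \<ge> 1"
    and "\<And>t. t \<in> {0..1} \<Longrightarrow> 0 \<le> \<psi> t"
    and "mono_on {0..1} \<psi>"
    and "continuous_on {0..1} \<psi>"
    and "(\<psi> \<longlongrightarrow> 0) (at_right 0)"
  shows "\<exists>c\<^sub>0>0. \<forall>\<mu> \<in> (M_class \<psi> :: (real^'n) measure set). \<exists>\<Delta>>0. \<forall>r\<^sub>0>0. \<forall>f :: real \<Rightarrow> real.
           (\<forall>t>0. 0 < f t \<and> f t \<le> t ^ CARD('n)) \<longrightarrow>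
           mono_on {0<..} f \<longrightarrow>
           (\<forall>\<^sub>F t in at_top. f t \<le> c\<^sub>0 * t ^ CARD('n)) \<longrightarrow>
           (\<forall>u \<in> F_class r\<^sub>0 A B \<mu>. f_oscillating \<Delta> \<mu> f u \<longrightarrow>
              Liminf at_top (\<lambda>R. ereal (ln (max_on_ball u R) /
                 (R / (1 + (f R / R) powr (1 / (real CARD('n) - 1)))
                    * ln (2 + f R / R) powr (real CARD('n) / (real CARD('n) - 1))))) > 0)"
proof -
  define d where "d = CARD('n)"
  define m where "m = d - 1"
  define v where "v = unit_ball_vol (real d)"
  define \<Delta> where "\<Delta> = 1 / (12 * A * B)"
  have m: "1 \<le> m" "d = Suc m" "real d - 1 = real m" using assms(1) by (auto simp: m_def d_def)
  have v: "0 < v" by (simp add: v_def)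
  have \<Delta>: "0 < \<Delta>" "12 * A * B * \<Delta> \<le> 1" using assms(2,3) by (auto simp: \<Delta>_def)
  obtain \<eta> where \<eta>: "0 < \<eta>" "2 * \<eta> \<le> 1" "\<psi> (2 * \<eta>) \<le> \<Delta>"
  proof -
    have "\<forall>\<^sub>F t in at_right 0. \<psi> t < \<Delta>"
      using order_tendstoD(2)[OF assms(7) \<Delta>(1)] .
    then obtain b where "0 < b" and b: "\<And>t. 0 < t \<Longrightarrow> t < b \<Longrightarrow> \<psi> t < \<Delta>"
      by (auto simp: eventually_at_right_field)
    show thesis
      by (rule that[of "min 1 (b / 2) / 2"]) (use \<open>0 < b\<close> in \<open>auto simp: min_def intro!: less_imp_le b\<close>)
  qed
  (* With \<kappa> the hypothesis "steps" of sup_growth holds with a factor 2 to spare; c\<^sub>1 gives its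
     hypothesis "few"; the second bound on c\<^sub>0 ensures n \<ge> 1. All three involve only A, B, d and \<psi>. *)
  define \<kappa> where "\<kappa> = \<eta> * v / (2 * 2 ^ d * (480 * 3 ^ d * 20 ^ m))"
  define c\<^sub>1 where "c\<^sub>1 = v / (2 * 6 ^ d * (1 + 20 ^ d / \<eta>))"
  define c\<^sub>0 where "c\<^sub>0 = min c\<^sub>1 (\<kappa> / 3 ^ m)"
  have \<kappa>: "0 < \<kappa>" using \<eta> v by (simp add: \<kappa>_def)
  have "0 < 1 + 20 ^ d / \<eta>" using \<eta> by (intro add_pos_nonneg) auto
  then have c: "0 < c\<^sub>1" "2 * (1 + 20 ^ d / \<eta>) * (c\<^sub>1 * 6 ^ d) = v" "0 < c\<^sub>0"
    using v \<kappa> by (auto simp: c\<^sub>1_def c\<^sub>0_def)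
  show ?thesis
  proof (rule exI[of _ c\<^sub>0], intro conjI c(3) ballI, rule exI[of _ \<Delta>], intro conjI \<Delta>(1) ballI allI impI)
    fix \<mu> :: "(real^'n) measure" and r\<^sub>0 :: real and f :: "real \<Rightarrow> real" and u :: "real^'n \<Rightarrow> real"
    assume \<mu>: "\<mu> \<in> M_class \<psi>" and r\<^sub>0: "0 < r\<^sub>0" and f: "\<forall>t>0. 0 < f t \<and> f t \<le> t ^ CARD('n)"
      and f_mono: "mono_on {0<..} f" and f_le: "\<forall>\<^sub>F t in at_top. f t \<le> c\<^sub>0 * t ^ CARD('n)"
      and u: "u \<in> F_class r\<^sub>0 A B \<mu>" and osc: "f_oscillating \<Delta> \<mu> f u"
    define \<tau> where "\<tau> = max (r\<^sub>0 + 1) ((real d)\<^sup>2 / \<eta>)"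
    have \<tau>: "0 < \<tau>" "r\<^sub>0 < \<tau>" "(real d)\<^sup>2 / \<eta> \<le> \<tau>" using r\<^sub>0 by (auto simp: \<tau>_def)
    define Q\<^sub>0 where "Q\<^sub>0 = max (4 ^ (m + 1)) ((\<kappa> * (4 * \<tau>) ^ m)\<^sup>2)"
    have Q\<^sub>0: "4 ^ (m + 1) \<le> Q\<^sub>0" "(\<kappa> * (4 * \<tau>) ^ m)\<^sup>2 \<le> Q\<^sub>0" by (auto simp: Q\<^sub>0_def)
    define K where "K = \<kappa> powr (1 / m) * (1 / (4 * ln (4 ^ (m + 1)))) powr ((m + 1) / m) / (12 * Q\<^sub>0 powr (1 / m))"
    have "(4::real) ^ 1 \<le> 4 ^ (m + 1)" by (rule power_increasing) auto
    then have "(4::real) \<le> 4 ^ (m + 1)" by (simp only: power_one_right)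
    then have "1 < Q\<^sub>0" using Q\<^sub>0(1) by linarith
    moreover have "0 < ln (4 ^ (m + 1) :: real)" by (intro ln_gt_zero one_less_power) auto
    ultimately have K: "0 < K" using \<kappa> by (simp add: K_def)
    (* The cube of half edge N = floor (R / 2) has edge at most R, so that f (2 * N) \<le> f R. *)
    have "filterlim (\<lambda>R::real. nat \<lfloor>R / 2\<rfloor>) sequentially at_top"
      unfolding filterlim_at_top
    proof
      fix k :: nat
      show "\<forall>\<^sub>F R::real in at_top. k \<le> nat \<lfloor>R / 2\<rfloor>"
        using eventually_ge_at_top[of "2 * real k"] by eventually_elim linarith
    qed
    then have rogue: "\<forall>\<^sub>F R::real in at_top.
        card (rogue_cubes \<Delta> \<mu> u (cbox (vec (- real (nat \<lfloor>R / 2\<rfloor>))) (vec (real (nat \<lfloor>R / 2\<rfloor>)))))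
        \<le> f (2 * real (nat \<lfloor>R / 2\<rfloor>))"
      using f by (intro eventually_compose_filterlim[OF rogue_count_le[OF osc]]) auto
    have "\<forall>\<^sub>F R in at_top. ereal K \<le> ereal (ln (max_on_ball u R) /
                 (R / (1 + (f R / R) powr (1 / (real CARD('n) - 1)))
                    * ln (2 + f R / R) powr (real CARD('n) / (real CARD('n) - 1))))"
      using rogue f_le eventually_ge_at_top[of 6] eventually_ge_at_top[of "3 * Q\<^sub>0 / \<kappa>"]
    proof eventually_elim
      case (elim R)
      define N where "N = real (nat \<lfloor>R / 2\<rfloor>)"
      define P where "P = real (card (rogue_cubes \<Delta> \<mu> u (cbox (vec (- N)) (vec N))))"
      define q where "q = f R / R"
      have R: "0 < R" using elim(3) by simp
      have N: "1 \<le> N" "R \<le> 3 * N" "2 * N \<le> R" using elim(3) unfolding N_def by linarith+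
      have fR: "0 < f R" "f (2 * N) \<le> f R"
        using f R N by (auto intro: mono_onD[OF f_mono])
      have P: "P \<le> f R" using elim(1) fR(2) by (simp add: P_def N_def)
      have q: "0 < q" "f R = q * R" using fR R by (auto simp: q_def)
      have RN: "R ^ k \<le> 3 ^ k * N ^ k" for k
        using power_mono[OF N(2), of k] R by (simp add: power_mult_distrib)
      have max_le: "max q Q\<^sub>0 \<le> \<kappa> * N ^ m"
      proof (rule max.boundedI)
        have "q * R \<le> c\<^sub>0 * R ^ m * R" using elim(2) q(2) m by (simp add: d_def mult_ac)
        then have "q \<le> c\<^sub>0 * R ^ m" using R by simp
        also have "\<dots> \<le> \<kappa> / 3 ^ m * (3 ^ m * N ^ m)"
          using RN[of m] c \<kappa> R by (intro mult_mono) (auto simp: c\<^sub>0_def)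
        finally show "q \<le> \<kappa> * N ^ m" by simp
        have "Q\<^sub>0 \<le> \<kappa> * (R / 3)" using elim(4) \<kappa> by (simp add: field_simps)
        also have "\<dots> \<le> \<kappa> * N ^ m"
          using N \<kappa> self_le_power[OF N(1), of m] m by (intro mult_left_mono) auto
        finally show "Q\<^sub>0 \<le> \<kappa> * N ^ m" .
      qed
      obtain n J :: nat where nJ: "1 \<le> n" "1 \<le> J" "real n ^ m * max q Q\<^sub>0 \<le> \<kappa> * real J * N ^ m"
          "2 ^ J * (4 * real n * \<tau>) \<le> N"
          "K * (R / (1 + q powr (1 / m)) * ln (2 + q) powr ((m + 1) / m)) \<le> real n * real J / 2"
        using exists_steps_and_scales[OF m(1) \<kappa> \<tau>(1) Q\<^sub>0 q(1) less_le_trans[OF zero_less_one N(1)]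
            less_imp_le[OF R] N(2) max_le] unfolding K_def by blast
      have few: "2 * (1 + 20 ^ d / \<eta>) * P \<le> v * (N / 2) ^ d"
      proof -
        have "P \<le> c\<^sub>0 * R ^ d" using P elim(2) by (simp add: d_def)
        also have "\<dots> \<le> c\<^sub>1 * (3 ^ d * N ^ d)"
          using RN[of d] c R by (intro mult_mono) (auto simp: c\<^sub>0_def)
        also have "\<dots> = c\<^sub>1 * 6 ^ d * (N / 2) ^ d"
        proof -
          have "(6::real) ^ d = 3 ^ d * 2 ^ d" by (simp flip: power_mult_distrib)
          then show ?thesis by (simp add: power_divide)
        qed
        finally have "2 * (1 + 20 ^ d / \<eta>) * P \<le> 2 * (1 + 20 ^ d / \<eta>) * (c\<^sub>1 * 6 ^ d * (N / 2) ^ d)"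
          using \<eta> by (intro mult_left_mono) auto
        also have "\<dots> = 2 * (1 + 20 ^ d / \<eta>) * (c\<^sub>1 * 6 ^ d) * (N / 2) ^ d" by (simp only: mult.assoc)
        finally show ?thesis using c(2) by simp
      qed
      have steps: "160 * 3 ^ d * (20 * real n) ^ (d - 1) * P < \<eta> * real J * (v * (N / 2) ^ d)"
      proof -
        have "P \<le> max q Q\<^sub>0 * (3 * N)"
        proof -
          have "q * R \<le> max q Q\<^sub>0 * (3 * N)"
            using q N R by (intro mult_mono) auto
          then show ?thesis using P q(2) by linarith
        qed
        then have "160 * 3 ^ d * (20 * real n) ^ m * P \<le> 160 * 3 ^ d * (20 * real n) ^ m * (max q Q\<^sub>0 * (3 * N))"
          by (intro mult_left_mono) auto
        also have "\<dots> = 480 * 3 ^ d * 20 ^ m * N * (real n ^ m * max q Q\<^sub>0)"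
          by (simp add: power_mult_distrib mult_ac)
        also have "\<dots> \<le> 480 * 3 ^ d * 20 ^ m * N * (\<kappa> * real J * N ^ m)"
          using nJ(3) N by (intro mult_left_mono) auto
        also have "\<dots> = \<eta> * real J * (v * (N / 2) ^ d) / 2"
          by (simp add: \<kappa>_def m(2) power_divide)
        also have "\<dots> < \<eta> * real J * (v * (N / 2) ^ d)"
          using \<eta> nJ(2) v N by (simp add: mult_pos_pos)
        finally show ?thesis by (simp add: m_def)
      qed
      have "exp (real n * real J / 2) \<le> (SUP y\<in>ball 0 N. u y)"
        using few steps nJ \<tau> unfolding P_def d_def v_def
        by (intro sup_growth[OF assms(1) \<mu> u assms(2,3,5) \<eta>(3,1,2) \<Delta>, of \<tau>]) auto
      also have "\<dots> \<le> max_on_ball u R"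
        unfolding max_on_ball_def using N u
        by (intro cSUP_subset_mono upper_semicontinuous_bdd_above) (auto simp: F_class_def)
      finally have M: "exp (real n * real J / 2) \<le> max_on_ball u R" .
      then have "real n * real J / 2 \<le> ln (max_on_ball u R)"
        using ln_ge_iff[OF less_le_trans[OF exp_gt_zero M]] by simp
      then have "K * (R / (1 + q powr (1 / m)) * ln (2 + q) powr ((m + 1) / m)) \<le> ln (max_on_ball u R)"
        using nJ(5) by linarith
      moreover have "0 < R / (1 + q powr (1 / m)) * ln (2 + q) powr ((m + 1) / m)"
        using R q by (intro mult_pos_pos divide_pos_pos add_pos_nonneg) auto
      ultimately have "K \<le> ln (max_on_ball u R) / (R / (1 + q powr (1 / m)) * ln (2 + q) powr ((m + 1) / m))"
        by (simp only: pos_le_divide_eq)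
      moreover have "real CARD('n) - 1 = real m" "real CARD('n) = real (m + 1)"
        using m by (auto simp: d_def)
      ultimately show ?case by (simp only: q_def ereal_less_eq)
    qed
    then have "ereal K \<le> Liminf at_top (\<lambda>R. ereal (ln (max_on_ball u R) /
                 (R / (1 + (f R / R) powr (1 / (real CARD('n) - 1)))
                    * ln (2 + f R / R) powr (real CARD('n) / (real CARD('n) - 1)))))"
      by (rule Liminf_bounded)
    moreover have "0 < ereal K" using K by simp
    ultimately show "0 < Liminf at_top (\<lambda>R. ereal (ln (max_on_ball u R) /
                 (R / (1 + (f R / R) powr (1 / (real CARD('n) - 1)))
                    * ln (2 + f R / R) powr (real CARD('n) / (real CARD('n) - 1)))))"
      by (rule less_le_trans[rotated])
  qed
qed

end
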